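(* Let $\rho<0$ and $\gamma<0$. Let $X$ and $Y$ be nonpositive random variables whose supports have upper endpoint $0$, and set $\widetilde X=-1/X$, $\widetilde Y=-1/Y$. Let $\widetilde\alpha\in RV_{-\rho}$ and $\widetilde a\in RV_{-\gamma}$ be positive functions and suppose there is a non-null Radon measure $\mu$ on $[0,\infty]\times(0,\infty]$ with $$t\,\mathbb P\left[\left(\frac{\widetilde X}{\widetilde\alpha(t)},\frac{\widetilde Y}{\widetilde a(t)}\right)\in\cdot\right]\xrightarrow{\ \mathrm v\ }\mu(\cdot)\quad\text{in } M_+([0,\infty]\times(0,\infty]),$$ and such that for each $y>0$, $x\mapsto\mu([0,x]\times(y,\infty])$ is a nondegenerate distribution function. Suppose also that for every $z>0$, $$\lim_{\epsilon\downarrow0}\limsup_{t\to\infty}t\,\mathbb P\left[\frac{\widetilde X}{\widetilde\alpha(t)}>\frac{z}{\epsilon}\right]=0.$$ Then $(XY)^{-1}$ has a regularly varying tail of index $-1/(|\gamma|+|\rho|)$, and as $t\to\infty$, $t\,\mathbb P\left[(XY)^{-1}/(\widetilde\alpha(t)\widetilde a(t))\in\cdot\right]$ converges vaguely to some nondegenerate Radon measure on $(0,\infty]$.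
   Context: $RV_c$ denotes the class of positive measurable functions $f$ with $f(tx)/f(x)\to t^c$ as $x\to\infty$ for all $t>0$; a random variable $W$ has a regularly varying tail of index $-c$ if $\mathbb P[W>\cdot]\in RV_{-c}$. Vague convergence in $M_+(\mathsf S)$ means convergence on relatively compact continuity sets of the limit. *)

theory Defs
  imports "HOL-Probability.Probability"
begin

definition RV :: "real \<Rightarrow> (real \<Rightarrow> real) \<Rightarrow> bool" where
  "RV c f \<longleftrightarrow> (\<forall>x>0. f x > 0) \<and> f \<in> borel_measurable (restrict_space borel {0<..}) \<and>
     (\<forall>t>0. ((\<lambda>x. f (t * x) / f x) \<longlongrightarrow> t powr c) at_top)"

definition radon_on :: "'b::topological_space set \<Rightarrow> 'b measure \<Rightarrow> bool" where
  "radon_on S \<mu> \<longleftrightarrow> sets \<mu> = sets borel \<and> emeasure \<mu> (UNIV - S) = 0 \<and>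
     (\<forall>K. compactin (top_of_set S) K \<longrightarrow> emeasure \<mu> K < \<infinity>)"

definition vague_conv ::
  "'b::topological_space set \<Rightarrow> (real \<Rightarrow> 'b set \<Rightarrow> ennreal) \<Rightarrow> 'b measure \<Rightarrow> bool" where
  "vague_conv S \<nu> \<mu> \<longleftrightarrow>
     (\<forall>B. B \<in> sets borel \<and> B \<subseteq> S \<and>
          compactin (top_of_set S) (top_of_set S closure_of B) \<and>
          emeasure \<mu> (top_of_set S frontier_of B) = 0 \<longrightarrow>
          ((\<lambda>t. \<nu> t B) \<longlongrightarrow> emeasure \<mu> B) at_top)"

definition nondegenerate_measure :: "'b set \<Rightarrow> 'b measure \<Rightarrow> bool" where
  "nondegenerate_measure S \<mu> \<longleftrightarrow> \<not> (\<exists>p. emeasure \<mu> (S - {p}) = 0)"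

definition nondeg_df :: "(real \<Rightarrow> ennreal) \<Rightarrow> bool" where
  "nondeg_df F \<longleftrightarrow> (\<forall>x\<ge>0. F x < \<infinity>) \<and> mono_on {0..} F \<and>
     (\<forall>x\<ge>0. (F \<longlongrightarrow> F x) (at_right x)) \<and>
     \<not> (\<exists>a c. \<forall>x\<ge>0. F x = (if a \<le> x then c else 0))"

definition neg_recip :: "real \<Rightarrow> ereal" where
  "neg_recip x = (if x = 0 then \<infinity> else ereal (- 1 / x))"

definition recip_e :: "real \<Rightarrow> ereal" where
  "recip_e x = (if x = 0 then \<infinity> else ereal (1 / x))"

end

theory Submission
  imports Defs
begin

text \<open>
  Write \<open>U = - 1 / X\<close>, \<open>W = - 1 / Y\<close> and \<open>b t = \<alpha> t * a t\<close>. The limit measure \<open>\<nu>\<close> is the image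
  of \<open>\<mu>\<close> under \<open>(x, y) \<mapsto> x * y\<close>, restricted to \<open>(0, \<infinity>]\<close>. The preimage of a set bounded away from
  \<open>0\<close> is not relatively compact in \<open>[0, \<infinity>] \<times> (0, \<infinity>]\<close>, so it is cut off at \<open>y > d\<close>; vague convergence
  handles the truncated set, and since \<open>x * y \<ge> w\<close> with \<open>y \<le> d\<close> forces \<open>x \<ge> w / d\<close>, the moment-type
  condition controls the remainder as \<open>d \<rightarrow> 0\<close>. Multiplication is discontinuous only at \<open>(0, \<infinity>)\<close>,
  which has no \<open>\<mu>\<close>-mass because a scaling limit along a regularly varying scale is a power law.
  The same scaling argument shows that \<open>\<nu> (w, \<infinity>] = C * w powr (- 1 / (\<bar>\<gamma>\<bar> + \<bar>\<rho>\<bar>))\<close>, where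
  \<open>C > 0\<close> since otherwise \<open>\<mu>\<close> would live on \<open>x = 0\<close>, contradicting nondegeneracy.
\<close>

section \<open>Scaling limits along regularly varying functions\<close>

text \<open>The substitution \<open>exp\<close> turns monotonicity on the half-line into
  monotonicity on the whole line, where a monotone function has only countably many discontinuities;
  an interval is uncountable.\<close>

lemma antimono_continuity_point_between:
  fixes G :: "real \<Rightarrow> real"
  assumes anti: "\<And>u v. 0 < u \<Longrightarrow> u \<le> v \<Longrightarrow> G v \<le> G u" and "0 < u" "u < v"
  obtains w where "u < w" "w < v" "isCont G w"
proof -
  define H where "H = (\<lambda>x. - G (exp x))"
  have "mono H"
    unfolding H_def by (intro monoI) (auto intro: anti)
  then have c: "countable {x. \<not> isCont H x}"
    by (rule mono_ctble_discont)
  have "uncountable {ln u<..<ln v}"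
    using assms(2,3) by (simp add: uncountable_open_interval)
  then have "\<not> {ln u<..<ln v} \<subseteq> {x. \<not> isCont H x}"
    using c countable_subset by blast
  then obtain x where x: "ln u < x" "x < ln v" "isCont H x" by auto
  have "isCont (\<lambda>w. H (ln w)) (exp x)"
    using x(3) by (intro isCont_o2[where f=ln and g=H] isCont_ln) simp_all
  then have cont: "isCont (\<lambda>w. - H (ln w)) (exp x)"
    by (rule continuous_minus)
  have "\<forall>\<^sub>F w in nhds (exp x). w \<in> {0<..}"
    by (rule eventually_nhds_in_open) auto
  then have "\<forall>\<^sub>F w in nhds (exp x). - H (ln w) = G w"
    by eventually_elim (auto simp: H_def)
  then have "isCont G (exp x)"
    using cont by (simp add: isCont_cong)
  moreover have "u < exp x"
    using exp_less_mono[OF x(1)] assms(2) by simp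
  moreover have "exp x < v"
    using exp_less_mono[OF x(2)] assms(2,3) by simp
  ultimately show ?thesis using that by blast
qed

text \<open>Running the limit along \<open>s * t\<close> instead of \<open>t\<close> divides it by
  \<open>s\<close>, while \<open>b (s * t)\<close> behaves like
  \<open>s powr \<kappa> * b t\<close>. Hence \<open>G (s powr \<kappa> * w) = G w / s\<close>, a
  functional equation whose solutions are power functions. Convergence is available only at
  continuity points of \<open>G\<close>, so the equation is first squeezed between such
  points.\<close>

lemma scaling_limit_power:
  fixes V b G :: "real \<Rightarrow> real"
  assumes kap: "0 < \<kappa>"
    and bpos: "\<And>x. 0 < x \<Longrightarrow> 0 < b x"
    and brv: "\<And>s. 0 < s \<Longrightarrow> ((\<lambda>x. b (s * x) / b x) \<longlongrightarrow> s powr \<kappa>) at_top"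
    and V: "antimono V"
    and anti: "\<And>u v. 0 < u \<Longrightarrow> u \<le> v \<Longrightarrow> G v \<le> G u"
    and rc: "\<And>w. 0 < w \<Longrightarrow> (G \<longlongrightarrow> G w) (at_right w)"
    and lim: "\<And>w. 0 < w \<Longrightarrow> isCont G w \<Longrightarrow> ((\<lambda>t. t * V (b t * w)) \<longlongrightarrow> G w) at_top"
    and w: "0 < w"
  shows "G w = G 1 * w powr (- 1 / \<kappa>)"
proof -
  have rescaled: "((\<lambda>t. t * V (b (s * t) * y)) \<longlongrightarrow> G y / s) at_top"
    if "0 < s" "0 < y" "isCont G y" for s y
  proof -
    have "filterlim (\<lambda>t. s * t) at_top at_top"
      using that(1) filterlim_tendsto_pos_mult_at_top[OF tendsto_const that(1) filterlim_ident] by simp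
    from filterlim_compose[OF lim[OF that(2,3)] this]
    have "((\<lambda>t. (s * t * V (b (s * t) * y)) / s) \<longlongrightarrow> G y / s) at_top"
      by (rule tendsto_divide) (use that in auto)
    then show ?thesis using that(1) by (simp add: mult.assoc)
  qed
  \<comment> \<open>The strict gap between \<open>s powr \<kappa> * y\<close> and \<open>u\<close>
    absorbs the error in \<open>b (s * t) / b t\<close>, so that eventually
    \<open>b (s * t) * y \<le> b t * u\<close>; antitonicity of \<open>V\<close> then compares the
    two limits.\<close>
  have upper: "G u \<le> G y / s"
    if s: "0 < s" and y: "0 < y" "isCont G y" and u: "isCont G u" "s powr \<kappa> * y < u" for s y u
  proof -
    have u0: "0 < u" using s y u by (smt (verit) mult_pos_pos powr_gt_zero)
    have "s powr \<kappa> < u / y" using u y by (simp add: field_simps)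
    then have "\<forall>\<^sub>F t in at_top. b (s * t) / b t < u / y"
      using brv[OF s] by (rule order_tendstoD(2)[rotated])
    then have "\<forall>\<^sub>F t in at_top. t * V (b t * u) \<le> t * V (b (s * t) * y)"
      using eventually_gt_at_top[of 0]
    proof eventually_elim
      case (elim t)
      then have "b (s * t) * y \<le> b t * u"
        using bpos[of t] y by (simp add: field_simps)
      then show ?case using elim V by (auto dest: antimonoD intro: mult_left_mono)
    qed
    then show ?thesis
      by (intro tendsto_le[OF _ rescaled[OF s y] lim[OF u0 u(1)]]) auto
  qed
  have lower: "G y / s \<le> G u"
    if s: "0 < s" and y: "0 < y" "isCont G y" and u: "0 < u" "isCont G u" "u < s powr \<kappa> * y" for s y u
  proof -
    have "u / y < s powr \<kappa>" using u y by (simp add: field_simps)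
    then have "\<forall>\<^sub>F t in at_top. u / y < b (s * t) / b t"
      using brv[OF s] by (rule order_tendstoD(1)[rotated])
    then have "\<forall>\<^sub>F t in at_top. t * V (b (s * t) * y) \<le> t * V (b t * u)"
      using eventually_gt_at_top[of 0]
    proof eventually_elim
      case (elim t)
      then have "b t * u \<le> b (s * t) * y"
        using bpos[of t] y by (simp add: field_simps)
      then show ?case using elim V by (auto dest: antimonoD intro: mult_left_mono)
    qed
    then show ?thesis
      by (intro tendsto_le[OF _ lim[OF u(1,2)] rescaled[OF s y]]) auto
  qed
  have scale: "G (s powr \<kappa> * w) = G w / s" if s: "0 < s" and w: "0 < w" for s w
  proof (rule antisym)
    have sk: "0 < s powr \<kappa>" using s by simp
    have sw: "0 < s powr \<kappa> * w" using w sk by simp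
    \<comment> \<open>The points \<open>u\<close> and \<open>y\<close> are continuity points
      slightly to the right of \<open>s powr \<kappa> * w\<close> and \<open>w\<close>. Approaching
      from the right suffices because \<open>G\<close> is right-continuous; the reverse inequality
      below lets \<open>y\<close> decrease to \<open>w\<close> in the same way.\<close>
    have "G v \<le> G w / s" if v: "s powr \<kappa> * w < v" for v
    proof -
      obtain u where u: "s powr \<kappa> * w < u" "u < v" "isCont G u"
        using antimono_continuity_point_between[where G=G, OF anti sw v] by blast
      have "w < u / s powr \<kappa>" using u sk by (simp add: field_simps)
      then obtain y where y: "w < y" "y < u / s powr \<kappa>" "isCont G y"
        using antimono_continuity_point_between[where G=G, OF anti w] by blast
      have "G v \<le> G u" using u sw by (intro anti) auto
      also have "\<dots> \<le> G y / s"
        using y u w s sk by (intro upper) (auto simp: field_simps)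
      also have "\<dots> \<le> G w / s"
        using y w s by (intro divide_right_mono anti) auto
      finally show ?thesis .
    qed
    then show "G (s powr \<kappa> * w) \<le> G w / s"
      by (intro tendsto_upperbound[OF rc[OF sw]]) (auto simp: eventually_at_filter)
    have "G y / s \<le> G (s powr \<kappa> * w)" if wy: "w < y" for y
    proof -
      obtain y' where y': "w < y'" "y' < y" "isCont G y'"
        using antimono_continuity_point_between[where G=G, OF anti w wy] by blast
      have "s powr \<kappa> * w < s powr \<kappa> * y'" using y' sk by simp
      then obtain u where u: "s powr \<kappa> * w < u" "u < s powr \<kappa> * y'" "isCont G u"
        using antimono_continuity_point_between[where G=G, OF anti sw] by blast
      have "G y / s \<le> G y' / s"
        using y' w s by (intro divide_right_mono anti) auto
      also have "\<dots> \<le> G u" using y' u w s less_trans[OF sw u(1)] by (intro lower) auto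
      also have "\<dots> \<le> G (s powr \<kappa> * w)" using u sw by (intro anti) auto
      finally show ?thesis .
    qed
    then show "G w / s \<le> G (s powr \<kappa> * w)"
      by (intro tendsto_upperbound[OF tendsto_divide[OF rc[OF w] tendsto_const]])
        (use s in \<open>auto simp: eventually_at_filter\<close>)
  qed
  \<comment> \<open>The functional equation is evaluated at the point 1 with
    \<open>s = w powr (1 / \<kappa>)\<close>.\<close>
  have "(w powr (1 / \<kappa>)) powr \<kappa> = w" using w kap by (simp add: powr_powr)
  then have "G w = G 1 / w powr (1 / \<kappa>)"
    using scale[of "w powr (1 / \<kappa>)" 1] w by simp
  then show ?thesis by (simp add: powr_minus_divide)
qed

lemma regular_variation_of_scaling_limit:
  fixes V b :: "real \<Rightarrow> real"
  assumes V: "antimono V" and Vpos: "\<And>x. 0 < V x" and V0: "(V \<longlongrightarrow> 0) at_top"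
    and C: "0 < C" and p: "0 < p" and bpos: "\<And>x. 0 < x \<Longrightarrow> 0 < b x"
    and lim: "\<And>w. 0 < w \<Longrightarrow> ((\<lambda>t. t * V (b t * w)) \<longlongrightarrow> C * w powr (- p)) at_top"
    and l: "0 < l"
  shows "((\<lambda>x. V (l * x) / V x) \<longlongrightarrow> l powr (- p)) at_top"
proof -
  text \<open>Evaluating along \<open>t = 1 / V x\<close> makes \<open>x\<close> asymptotic to \<open>b t * C powr (1 / p)\<close>, so no
    asymptotic inverse of \<open>b\<close> is needed.\<close>
  define T where "T x = 1 / V x" for x
  define w0 where "w0 = C powr (1 / p)"
  have w0: "0 < w0" using C by (simp add: w0_def)
  have w0p: "C * w0 powr (- p) = 1"
    using C p by (simp add: w0_def powr_powr powr_minus)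
  have T: "filterlim T at_top at_top"
    unfolding T_def divide_inverse using filterlim_inverse_at_top[OF V0] Vpos by simp
  have limT: "((\<lambda>x. V (b (T x) * w) / V x) \<longlongrightarrow> C * w powr (- p)) at_top" if "0 < w" for w
    using filterlim_compose[OF lim[OF that] T] by (simp add: T_def)
  have cont: "((\<lambda>w. C * (l * w) powr (- p)) \<longlongrightarrow> C * (l * w0) powr (- p)) (at w0 within A)" for A
    using l w0 by (intro tendsto_intros) auto
  have Cl: "C * (l * w0) powr (- p) = l powr (- p)"
    using w0p l w0 by (simp add: powr_mult mult.left_commute)
  \<comment> \<open>Beyond \<open>w0\<close> the limit of \<open>V (b (T x) * w) / V x\<close> is
    below 1, and a strict inequality between values of an antitone function orders the
    arguments.\<close>
  have above: "\<forall>\<^sub>F x in at_top. x \<le> b (T x) * w" if "w0 < w" for w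
  proof -
    have "C * w powr (- p) < 1"
      using that w0 C p powr_less_mono2_neg[of "-p" w0 w] w0p mult_strict_left_mono[of _ _ C]
      by (metis neg_less_0_iff_less)
    then have "\<forall>\<^sub>F x in at_top. V (b (T x) * w) / V x < 1"
      using limT that w0 by (intro order_tendstoD(2)) auto
    then show ?thesis
    proof eventually_elim
      case (elim x)
      then have "V (b (T x) * w) < V x" using Vpos[of x] by simp
      then show ?case using antimonoD[OF V, of "b (T x) * w" x] by linarith
    qed
  qed
  have below: "\<forall>\<^sub>F x in at_top. b (T x) * w \<le> x" if "0 < w" "w < w0" for w
  proof -
    have "1 < C * w powr (- p)"
      using that w0 C p powr_less_mono2_neg[of "-p" w w0] w0p mult_strict_left_mono[of _ _ C]
      by (metis neg_less_0_iff_less)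
    then have "\<forall>\<^sub>F x in at_top. 1 < V (b (T x) * w) / V x"
      using limT that w0 by (intro order_tendstoD(1)) auto
    then show ?thesis
    proof eventually_elim
      case (elim x)
      then have "V x < V (b (T x) * w)" using Vpos[of x] by simp
      then show ?case using antimonoD[OF V, of x "b (T x) * w"] by linarith
    qed
  qed
  show ?thesis
  proof (rule order_tendstoI)
    \<comment> \<open>The value \<open>l powr (- p)\<close> is that of
      \<open>C * (l * w) powr (- p)\<close> at \<open>w0\<close>. By continuity some
      \<open>w\<close> on the left of \<open>w0\<close> still gives a value below \<open>u\<close>,
      and there \<open>x\<close> dominates \<open>b (T x) * w\<close>. The lower bound mirrors this
      on the right of \<open>w0\<close>.\<close>
    fix u assume "l powr (- p) < u"
    then have "\<forall>\<^sub>F w in at_left w0. C * (l * w) powr (- p) < u"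
      using order_tendstoD(2)[OF cont] Cl by simp
    then have "\<forall>\<^sub>F w in at_left w0. C * (l * w) powr (- p) < u \<and> 0 < w \<and> w < w0"
      using eventually_at_left_real[OF w0] by eventually_elim auto
    then obtain w where w: "C * (l * w) powr (- p) < u" "0 < w" "w < w0"
      using eventually_happens trivial_limit_at_left_real by blast
    have "\<forall>\<^sub>F x in at_top. V (b (T x) * (l * w)) / V x < u"
      using w l by (intro order_tendstoD(2)[OF limT]) auto
    with below[OF w(2,3)] show "\<forall>\<^sub>F x in at_top. V (l * x) / V x < u"
    proof eventually_elim
      case (elim x)
      have "V (l * x) \<le> V (b (T x) * (l * w))"
        using elim(1) l by (intro antimonoD[OF V]) (simp add: mult.left_commute)
      then have "V (l * x) / V x \<le> V (b (T x) * (l * w)) / V x"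
        using Vpos[of x] by (simp add: divide_right_mono)
      then show ?case using elim by simp
    qed
  next
    fix u assume "u < l powr (- p)"
    then have "\<forall>\<^sub>F w in at_right w0. u < C * (l * w) powr (- p)"
      using order_tendstoD(1)[OF cont] Cl by simp
    then have "\<forall>\<^sub>F w in at_right w0. u < C * (l * w) powr (- p) \<and> w0 < w"
      by (auto intro!: eventually_conj simp: eventually_at_filter)
    then obtain w where w: "u < C * (l * w) powr (- p)" "w0 < w"
      using eventually_happens trivial_limit_at_right_real by blast
    have "\<forall>\<^sub>F x in at_top. u < V (b (T x) * (l * w)) / V x"
      using w l w0 by (intro order_tendstoD(1)[OF limT]) auto
    with above[OF w(2)] show "\<forall>\<^sub>F x in at_top. u < V (l * x) / V x"
    proof eventually_elim
      case (elim x)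
      have "V (b (T x) * (l * w)) \<le> V (l * x)"
        using elim(1) l by (intro antimonoD[OF V]) (simp add: mult.left_commute)
      then have "V (b (T x) * (l * w)) / V x \<le> V (l * x) / V x"
        using Vpos[of x] by (simp add: divide_right_mono)
      then show ?case using elim by simp
    qed
  qed
qed

section \<open>Topology of the punctured quadrant\<close>

text \<open>A point near which membership in \<open>E\<close> is constant relative to
  \<open>S\<close> lies either outside the closure or inside the interior. Only an upper bound for
  the frontier is needed, since it is later compared with null sets.\<close>

lemma frontier_of_subset_if_locally_constant:
  assumes "\<And>p. p \<in> S \<Longrightarrow> p \<notin> N \<Longrightarrow> \<exists>T. open T \<and> p \<in> T \<and> (S \<inter> T \<inter> E = {} \<or> S \<inter> T \<subseteq> E)"
  shows "top_of_set S frontier_of E \<subseteq> N"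
proof
  fix p assume p: "p \<in> top_of_set S frontier_of E"
  show "p \<in> N"
  proof (rule ccontr)
    assume "p \<notin> N"
    moreover have pS: "p \<in> S"
      using p by (auto simp: frontier_of_def in_closure_of)
    ultimately obtain T where T: "open T" "p \<in> T" "S \<inter> T \<inter> E = {} \<or> S \<inter> T \<subseteq> E"
      using assms by blast
    have o: "openin (top_of_set S) (S \<inter> T)" using T by (simp add: openin_open_Int)
    from T(3) show False
    proof
      assume "S \<inter> T \<inter> E = {}"
      then show False using p o pS T(2) by (auto simp: frontier_of_def in_closure_of)
    next
      assume "S \<inter> T \<subseteq> E"
      then show False using p o pS T(2) by (auto simp: frontier_of_def interior_of_def)
    qed
  qed
qed

lemma compactin_closure_of_subset:
  assumes "compact K" "K \<subseteq> S" "closed K" "B \<subseteq> K"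
  shows "compactin (top_of_set S) (top_of_set S closure_of B)"
proof (rule closed_compactin)
  show "compactin (top_of_set S) K"
    using assms by (simp add: compactin_subtopology)
  show "top_of_set S closure_of B \<subseteq> K"
    using assms by (intro closure_of_minimal) (auto intro: closed_subset)
qed simp

text \<open>A compact set attains its minimum, which is positive here; a real \<open>w\<close>
  strictly below it exists even if the minimum is \<infinity>. Relatively compact subsets of (0,
  \<infinity>] are therefore exactly those bounded away from 0.\<close>

lemma compact_pos_ereal_lower_bound:
  fixes K :: "ereal set"
  assumes "compact K" "K \<subseteq> {0<..}"
  obtains w where "0 < w" "K \<subseteq> {ereal w..}"
proof (cases "K = {}")
  case True then show ?thesis using that[of 1] by auto
next
  case False
  then obtain k where k: "k \<in> K" "\<And>x. x \<in> K \<Longrightarrow> k \<le> x"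
    using compact_attains_inf[OF assms(1)] by blast
  then have "0 < k" using assms by auto
  then obtain w where "0 < ereal w" "ereal w < k" using ereal_dense2 by blast
  then show ?thesis using that[of w] k by fastforce
qed

text \<open>The restriction of \<open>N\<close> to \<open>S\<close> is finite, hence so is its image
  under \<open>f\<close>, and a finite measure has only countably many atoms. This lets cut levels
  be chosen with null boundary.\<close>

lemma countable_atoms_of_image:
  fixes f :: "'b \<Rightarrow> 'c::{second_countable_topology, t1_space}"
  assumes f: "f \<in> borel_measurable N" and S: "S \<in> sets N" and fin: "emeasure N S < \<infinity>"
  shows "countable {c. emeasure N ({p \<in> space N. f p = c} \<inter> S) \<noteq> 0}"
proof -
  let ?D = "distr (density N (indicator S)) borel f"
  have e: "emeasure ?D A = emeasure N ((f -` A \<inter> space N) \<inter> S)" if "A \<in> sets borel" for A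
    using f S that
    by (subst emeasure_distr)
      (auto simp: emeasure_restricted measurable_sets Int_commute intro!: measurable_sets[OF f])
  interpret D: finite_measure ?D
  proof (rule finite_measureI)
    have "f -` UNIV \<inter> space N \<inter> S = S" using sets.sets_into_space[OF S] by auto
    then show "emeasure ?D (space ?D) \<noteq> \<infinity>" using fin e[of UNIV] by simp
  qed
  have "emeasure N ({p \<in> space N. f p = c} \<inter> S) = measure ?D {c}" for c
    using e[of "{c}"] by (simp add: D.emeasure_eq_measure vimage_def Int_def conj_commute)
  then have "{c. emeasure N ({p \<in> space N. f p = c} \<inter> S) \<noteq> 0} \<subseteq> {c. measure ?D {c} \<noteq> 0}"
    by auto
  then show ?thesis using D.countable_support countable_subset by blast
qed

text \<open>The boundary has three sources: the preimage of the boundary of \<open>B\<close>, the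
  cut at height \<open>d\<close>, and the point (0, \<infinity>) where multiplication is
  discontinuous. The whole line at height \<infinity> is given away for the last one, since it turns
  out to be null.\<close>

lemma frontier_of_product_set:
  fixes B :: "ereal set" and d :: ereal
  assumes B: "B \<subseteq> {w0..}" "0 < w0" and d: "0 < d"
  shows "top_of_set ({0..} \<times> {0<..}) frontier_of {p \<in> {0..} \<times> {d<..}. fst p * snd p \<in> B}
    \<subseteq> {p. fst p * snd p \<in> top_of_set {0<..} frontier_of B} \<union> {p. snd p = d} \<union> {p. snd p = \<infinity>}"
    (is "top_of_set ?S frontier_of ?E \<subseteq> ?N")
proof (rule frontier_of_subset_if_locally_constant)
  fix p :: "ereal \<times> ereal" assume p: "p \<in> ?S" "p \<notin> ?N"
  \<comment> \<open>As \<open>B\<close> stays above \<open>w0 > 0\<close>, its boundary in the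
    extended reals does not reach 0, so passing to the subspace loses nothing.\<close>
  have fr: "top_of_set {0<..} frontier_of B = frontier B"
  proof -
    have "closure B \<subseteq> {w0..}" using B by (intro closure_minimal) auto
    then have "frontier B \<subseteq> {0<..}" using B(2) by (force simp: frontier_def)
    then show ?thesis by (subst frontier_of_subtopology_open) (auto simp: frontier_of_def frontier_def)
  qed
  show "\<exists>T. open T \<and> p \<in> T \<and> (?S \<inter> T \<inter> ?E = {} \<or> ?S \<inter> T \<subseteq> ?E)"
  proof (cases "snd p < d")
    case True
    moreover have "open {p::ereal \<times> ereal. snd p < d}"
      by (intro open_Collect_less continuous_intros)
    ultimately show ?thesis by (intro exI[of _ "{p. snd p < d}"]) auto
  next
    case False
    then have sd: "d < snd p" using p(2) by auto
    \<comment> \<open>Here \<open>snd p\<close> is neither 0 nor \<infinity>, so no product of 0 and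
      \<infinity> occurs at \<open>p\<close>.\<close>
    have lim: "((\<lambda>q. fst q * snd q) \<longlongrightarrow> fst p * snd p) (nhds p)"
      using p by (intro tendsto_mult_ereal tendsto_fst tendsto_snd filterlim_ident) auto
    have od: "\<forall>\<^sub>F q in nhds p. d < snd q"
      by (intro order_tendstoD(1)[OF tendsto_snd[OF filterlim_ident] sd])
    have "fst p * snd p \<in> interior B \<or> fst p * snd p \<in> - closure B"
      using p(2) fr by (auto simp: frontier_def)
    then show ?thesis
    proof
      assume "fst p * snd p \<in> interior B"
      then have "\<forall>\<^sub>F q in nhds p. fst q * snd q \<in> interior B"
        by (intro topological_tendstoD[OF lim]) auto
      with od have "\<forall>\<^sub>F q in nhds p. d < snd q \<and> fst q * snd q \<in> interior B"
        by eventually_elim auto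
      then show ?thesis using interior_subset[of B] unfolding eventually_nhds by fastforce
    next
      assume "fst p * snd p \<in> - closure B"
      then have "\<forall>\<^sub>F q in nhds p. fst q * snd q \<in> - closure B"
        by (intro topological_tendstoD[OF lim]) auto
      then obtain T where "open T" "p \<in> T" "\<forall>q\<in>T. fst q * snd q \<notin> closure B"
        unfolding eventually_nhds by auto
      then show ?thesis using closure_subset[of B] by (intro exI[of _ T]) auto
    qed
  qed
qed

lemma frontier_of_strip:
  fixes c y :: ereal
  assumes "0 < y"
  shows "top_of_set ({0..} \<times> {0<..}) frontier_of (({0..} \<inter> {c<..}) \<times> {y<..}) \<subseteq>
     {p. fst p = c} \<union> {p. snd p = y}"
proof (rule frontier_of_subset_if_locally_constant)
  fix p :: "ereal \<times> ereal" assume p: "p \<notin> {p. fst p = c} \<union> {p. snd p = y}"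
  then consider "fst p < c" | "snd p < y" | "c < fst p" "y < snd p"
    by (auto simp: neq_iff)
  then show "\<exists>T. open T \<and> p \<in> T \<and> ({0..} \<times> {0<..} \<inter> T \<inter> (({0..} \<inter> {c<..}) \<times> {y<..}) = {} \<or>
      {0..} \<times> {0<..} \<inter> T \<subseteq> ({0..} \<inter> {c<..}) \<times> {y<..})"
  proof cases
    case 1 then show ?thesis
      by (intro exI[of _ "{..<c} \<times> UNIV"]) (auto intro!: open_Times simp: mem_Times_iff)
  next
    case 2 then show ?thesis
      by (intro exI[of _ "UNIV \<times> {..<y}"]) (auto intro!: open_Times simp: mem_Times_iff)
  next
    case 3 then show ?thesis
      by (intro exI[of _ "{c<..} \<times> {y<..}"]) (auto intro!: open_Times simp: mem_Times_iff)
  qed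
qed

section \<open>Tails of measures on the extended reals\<close>

text \<open>These are the properties that allow the tail of \<open>N\<close> to act as the function
  \<open>G\<close> of \<open>scaling_limit_power\<close>. Right-continuity is continuity from below,
  since the sets \<open>{ereal y<..}\<close> increase as \<open>y\<close> decreases.\<close>

lemma ereal_tail_measure:
  fixes N :: "ereal measure"
  assumes sets: "sets N = sets borel"
    and fin: "\<And>y. 0 < y \<Longrightarrow> emeasure N {ereal y<..} < \<infinity>"
  shows ereal_tail_antimono:
      "\<And>u v. 0 < u \<Longrightarrow> u \<le> v \<Longrightarrow> measure N {ereal v<..} \<le> measure N {ereal u<..}"
    and ereal_tail_right_continuous:
      "\<And>w. 0 < w \<Longrightarrow> ((\<lambda>y. measure N {ereal y<..}) \<longlongrightarrow> measure N {ereal w<..}) (at_right w)"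
    and ereal_tail_isCont_imp_no_atom:
      "\<And>w. 0 < w \<Longrightarrow> isCont (\<lambda>y. measure N {ereal y<..}) w \<Longrightarrow> emeasure N {ereal w} = 0"
    and ereal_top_atom_le_tail:
      "\<And>w. 0 < w \<Longrightarrow> emeasure N {\<infinity>} \<le> ennreal (measure N {ereal w<..})"
proof -
  have fm: "A \<in> fmeasurable N" if "0 < u" "A \<subseteq> {ereal u<..}" "A \<in> sets borel" for u A
    using that sets fin[OF that(1)] emeasure_mono[of A "{ereal u<..}" N]
    by (intro fmeasurableI) (auto simp: order.strict_trans1)
  show anti: "measure N {ereal v<..} \<le> measure N {ereal u<..}" if "0 < u" "u \<le> v" for u v
    using that by (intro measure_mono_fmeasurable fm[of u]) (auto simp: sets order.strict_trans1)
  show "((\<lambda>y. measure N {ereal y<..}) \<longlongrightarrow> measure N {ereal w<..}) (at_right w)" if w: "0 < w" for w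
  proof (rule tendsto_at_right_sequentially[of w "w + 1"])
    fix S assume S: "\<And>n. w < S n" "\<And>n. S n < w + 1" "decseq S" "S \<longlonglongrightarrow> w"
    have Sw: "ereal w < x" if "ereal (S n) < x" for n x
      using S(1)[of n] that by (metis less_ereal.simps(1) less_trans)
    have "(\<lambda>n. measure N {ereal (S n)<..}) \<longlonglongrightarrow> measure N (\<Union>n. {ereal (S n)<..})"
    proof (rule Lim_measure_incseq)
      show "incseq (\<lambda>n. {ereal (S n)<..})"
        using S(3) by (auto simp: incseq_def decseq_def intro: le_less_trans)
      have "(\<Union>n. {ereal (S n)<..}) \<subseteq> {ereal w<..}"
        by (auto intro: Sw)
      then show "emeasure N (\<Union>n. {ereal (S n)<..}) \<noteq> \<infinity>"
        using fmeasurableD2[OF fm[OF w]] by auto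
    qed (auto simp: sets)
    moreover have "(\<Union>n. {ereal (S n)<..}) = {ereal w<..}"
    proof (intro equalityI subsetI)
      fix x assume x: "x \<in> {ereal w<..}"
      then obtain r where r: "ereal w < ereal r" "ereal r < x" using ereal_dense2[of "ereal w" x] by auto
      then have "\<forall>\<^sub>F n in sequentially. S n < r" using S(4) by (intro order_tendstoD(2)) auto
      then obtain n where "S n < r" by (auto simp: eventually_sequentially)
      then show "x \<in> (\<Union>n. {ereal (S n)<..})"
        using r by (auto intro!: exI[of _ n] intro: less_trans[of "ereal (S n)" "ereal r"])
    qed (auto intro: Sw)
    ultimately show "(\<lambda>n. measure N {ereal (S n)<..}) \<longlonglongrightarrow> measure N {ereal w<..}" by simp
  qed simp
  show "emeasure N {ereal w} = 0" if w: "0 < w" and c: "isCont (\<lambda>y. measure N {ereal y<..}) w" for w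
  proof -
    let ?G = "\<lambda>y. measure N {ereal y<..}"
    \<comment> \<open>The atom at \<open>w\<close> is bounded by the drop of the tail across
      \<open>w\<close>, which vanishes at a continuity point.\<close>
    have "\<forall>\<^sub>F z in at_left w. measure N {ereal w} \<le> ?G z - ?G w"
      using eventually_at_left_real[OF w]
    proof eventually_elim
      case (elim z)
      have "measure N {ereal w} + ?G w = measure N ({ereal w} \<union> {ereal w<..})"
        using elim fm[of z "{ereal w}"] fm[of z "{ereal w<..}"]
        by (intro measure_Union[symmetric]) (auto dest!: fmeasurableD2 simp: sets intro: less_trans[of "ereal z"])
      also have "\<dots> \<le> ?G z"
        using elim by (intro measure_mono_fmeasurable fm[of z]) (auto simp: sets intro: less_trans[of "ereal z"])
      finally show ?case by simp
    qed
    moreover have "((\<lambda>z. ?G z - ?G w) \<longlongrightarrow> 0) (at_left w)"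
      using c by (intro tendsto_eq_intros) (auto simp: isCont_def filterlim_at_split)
    ultimately have "measure N {ereal w} \<le> 0"
      by (intro tendsto_lowerbound[of _ 0 "at_left w"]) auto
    then have "measure N {ereal w} = 0" by (simp add: measure_le_0_iff)
    moreover have "{ereal w} \<in> fmeasurable N"
      using w by (intro fm[of "w / 2"]) auto
    ultimately show ?thesis by (simp add: emeasure_eq_measure2)
  qed
  show "emeasure N {\<infinity>} \<le> ennreal (measure N {ereal w<..})" if "0 < w" for w
    using fm[OF that, of "{ereal w<..}"] sets emeasure_mono[of "{\<infinity>}" "{ereal w<..}" N]
    by (auto simp: emeasure_eq_measure2)
qed

text \<open>Convergence is assumed only at levels without an atom, which include all continuity
  points of the tail. This already forces a power law; its continuity then excludes every finite
  positive atom, and its decay to 0 excludes an atom at \<infinity>.\<close>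

lemma ereal_tail_power_law:
  fixes N :: "ereal measure" and V b :: "real \<Rightarrow> real"
  assumes sets: "sets N = sets borel"
    and fin: "\<And>y. 0 < y \<Longrightarrow> emeasure N {ereal y<..} < \<infinity>"
    and kap: "0 < \<kappa>"
    and bpos: "\<And>x. 0 < x \<Longrightarrow> 0 < b x"
    and brv: "\<And>s. 0 < s \<Longrightarrow> ((\<lambda>x. b (s * x) / b x) \<longlongrightarrow> s powr \<kappa>) at_top"
    and V: "antimono V"
    and lim: "\<And>w. 0 < w \<Longrightarrow> emeasure N {ereal w} = 0 \<Longrightarrow>
      ((\<lambda>t. t * V (b t * w)) \<longlongrightarrow> measure N {ereal w<..}) at_top"
  shows ereal_tail_power: "\<And>w. 0 < w \<Longrightarrow>
      measure N {ereal w<..} = measure N {1<..} * w powr (- 1 / \<kappa>)"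
    and ereal_tail_no_atom: "\<And>w. 0 < w \<Longrightarrow> emeasure N {ereal w} = 0"
    and ereal_tail_no_top_atom: "emeasure N {\<infinity>} = 0"
proof -
  let ?G = "\<lambda>y. measure N {ereal y<..}"
  show power: "?G w = measure N {1<..} * w powr (- 1 / \<kappa>)" if "0 < w" for w
    using scaling_limit_power[of \<kappa> b V ?G w] kap bpos brv V lim that
      ereal_tail_antimono[OF sets fin] ereal_tail_right_continuous[OF sets fin]
      ereal_tail_isCont_imp_no_atom[OF sets fin]
    by (simp add: one_ereal_def)
  show "emeasure N {ereal w} = 0" if w: "0 < w" for w
  proof (rule ereal_tail_isCont_imp_no_atom[OF sets fin w])
    have "isCont (\<lambda>w. measure N {1<..} * w powr (- 1 / \<kappa>)) w"
      using w by (intro continuous_intros) auto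
    moreover have "\<forall>\<^sub>F y in nhds w. ?G y = measure N {1<..} * y powr (- 1 / \<kappa>)"
      using eventually_nhds_in_open[of "{0<..}" w] w by (auto elim!: eventually_mono simp: power)
    ultimately show "isCont ?G w" by (simp add: isCont_cong)
  qed
  have "((\<lambda>w. measure N {1<..} * w powr (- (1 / \<kappa>))) \<longlongrightarrow> measure N {1<..} * 0) at_top"
    using kap by (intro tendsto_mult tendsto_const tendsto_neg_powr filterlim_ident) auto
  moreover have "\<forall>\<^sub>F w in at_top. measure N {1<..} * w powr (- (1 / \<kappa>)) = ?G w"
    using eventually_gt_at_top[of 0] by eventually_elim (simp add: power)
  ultimately have "(?G \<longlongrightarrow> 0) at_top"
    by (simp add: tendsto_cong)
  then have "((\<lambda>w. ennreal (?G w)) \<longlongrightarrow> ennreal 0) at_top"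
    by (rule tendsto_ennrealI)
  moreover have "\<forall>\<^sub>F w in at_top. emeasure N {\<infinity>} \<le> ennreal (?G w)"
    using eventually_gt_at_top[of 0] by eventually_elim (rule ereal_top_atom_le_tail[OF sets fin])
  ultimately show "emeasure N {\<infinity>} = 0"
    using tendsto_lowerbound[of "\<lambda>w. ennreal (?G w)" 0 at_top "emeasure N {\<infinity>}"] by simp
qed

section \<open>The joint tail limit\<close>

text \<open>\<open>U\<close> and \<open>W\<close> stand for -1/X and -1/Y, with values in (0,
  \<infinity>] because X and Y may vanish. The positive indices \<open>\<kappa>\<^sub>1\<close> and
  \<open>\<kappa>\<^sub>2\<close> stand for -\<rho> and -\<gamma>.\<close>

locale joint_tail_limit = prob_space M for M :: "'a measure" +
  fixes U W :: "'a \<Rightarrow> ereal" and \<alpha> a :: "real \<Rightarrow> real" and \<kappa>\<^sub>1 \<kappa>\<^sub>2 :: real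
    and \<mu> :: "(ereal \<times> ereal) measure"
  assumes U_measurable [measurable]: "U \<in> borel_measurable M"
    and W_measurable [measurable]: "W \<in> borel_measurable M"
    and U_pos: "\<And>\<omega>. \<omega> \<in> space M \<Longrightarrow> 0 < U \<omega>"
    and W_pos: "\<And>\<omega>. \<omega> \<in> space M \<Longrightarrow> 0 < W \<omega>"
    and indices_pos: "0 < \<kappa>\<^sub>1" "0 < \<kappa>\<^sub>2"
    and RV_\<alpha>: "RV \<kappa>\<^sub>1 \<alpha>" and RV_a: "RV \<kappa>\<^sub>2 a"
    and radon: "radon_on ({0..} \<times> {0<..}) \<mu>"
    and vague: "vague_conv ({0..} \<times> {0<..})
           (\<lambda>t B. ennreal t * emeasure M {\<omega>\<in>space M. (U \<omega> / ereal (\<alpha> t), W \<omega> / ereal (a t)) \<in> B}) \<mu>"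
    and nondeg: "\<And>y. 0 < y \<Longrightarrow> nondeg_df (\<lambda>x. emeasure \<mu> ({0..ereal x} \<times> {ereal y<..}))"
    and moment: "\<And>z. 0 < z \<Longrightarrow> ((\<lambda>\<epsilon>. Limsup at_top (\<lambda>t. ennreal t * emeasure M {\<omega>\<in>space M.
              U \<omega> / ereal (\<alpha> t) > ereal (z / \<epsilon>)})) \<longlongrightarrow> 0) (at_right 0)"
begin

definition joint :: "real \<Rightarrow> (ereal \<times> ereal) set \<Rightarrow> ennreal" where
  "joint t B = ennreal t * emeasure M {\<omega>\<in>space M. (U \<omega> / ereal (\<alpha> t), W \<omega> / ereal (a t)) \<in> B}"

definition tailU :: "real \<Rightarrow> real \<Rightarrow> ennreal" where
  "tailU c t = ennreal t * emeasure M {\<omega>\<in>space M. U \<omega> / ereal (\<alpha> t) > ereal c}"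

text \<open>The density removes the products equal to 0, which come from the axis x = 0 and lie
  outside the state space (0, \<infinity>].\<close>

definition \<nu> :: "ereal measure" where
  "\<nu> = density (distr \<mu> borel (\<lambda>p. fst p * snd p)) (indicator {0<..})"

section \<open>Strips bounded away from the axis y = 0, and limits on them\<close>

lemma sets_\<mu> [simp, measurable_cong]: "sets \<mu> = sets borel"
  using radon by (simp add: radon_on_def)

lemma space_\<mu> [simp]: "space \<mu> = UNIV"
  using sets_eq_imp_space_eq[OF sets_\<mu>] by simp

lemma sets_\<nu> [simp, measurable_cong]: "sets \<nu> = sets borel"
  by (simp add: \<nu>_def)

lemma measurable_product [measurable]:
  "(\<lambda>p. fst p * snd p) \<in> borel_measurable (borel :: (ereal \<times> ereal) measure)"
  unfolding borel_prod[symmetric] by measurable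

lemma \<alpha>_pos: "0 < t \<Longrightarrow> 0 < \<alpha> t" and a_pos: "0 < t \<Longrightarrow> 0 < a t"
  using RV_\<alpha> RV_a by (auto simp: RV_def)

lemma borel_Times [measurable]:
  "A \<in> sets borel \<Longrightarrow> B \<in> sets borel \<Longrightarrow> A \<times> B \<in> sets (borel :: (ereal \<times> ereal) measure)"
  unfolding borel_prod[symmetric] by (rule pair_measureI)

lemma emeasure_Int_support:
  assumes "A \<in> sets borel"
  shows "emeasure \<mu> A = emeasure \<mu> (A \<inter> ({0..} \<times> {0<..}))"
proof -
  have "AE p in \<mu>. p \<in> {0..} \<times> {0<..}"
    using radon by (intro AE_I[of _ _ "UNIV - {0..} \<times> {0<..}"]) (auto simp: radon_on_def)
  then show ?thesis
    using assms by (intro emeasure_eq_AE) auto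
qed

text \<open>The state space is closed at x = 0 and at both infinities, so compactness only requires
  the second coordinate to stay away from 0.\<close>

lemma compact_strip:
  assumes "0 < y"
  shows "compact ({0..} \<times> {ereal y..} :: (ereal \<times> ereal) set)"
    and "{0..} \<times> {ereal y..} \<subseteq> ({0..} \<times> {0<..} :: (ereal \<times> ereal) set)"
proof -
  show "compact ({0..} \<times> {ereal y..} :: (ereal \<times> ereal) set)"
    by (intro compact_Times) (simp_all add: compact_eq_closed)
  have "0 < x" if "ereal y \<le> x" for x
    using assms that by (metis less_ereal.simps(1) less_le_trans zero_ereal_def)
  then show "{0..} \<times> {ereal y..} \<subseteq> ({0..} \<times> {0<..} :: (ereal \<times> ereal) set)" by auto
qed

lemma emeasure_strip_finite:
  assumes "0 < y"
  shows "emeasure \<mu> ({0..} \<times> {ereal y..}) < \<infinity>"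
  using radon compact_strip[OF assms] by (simp add: radon_on_def compactin_subtopology)

text \<open>The closure of \<open>E\<close> stays in the compact strip, so \<open>E\<close> is
  relatively compact and only the part of its frontier inside the strip has to be null.\<close>

lemma joint_tendsto:
  assumes E: "E \<in> sets borel" "E \<subseteq> {0..} \<times> {ereal y..}" and y: "0 < y"
    and fr: "top_of_set ({0..} \<times> {0<..}) frontier_of E \<inter> ({0..} \<times> {ereal y..}) \<subseteq> N"
    and N: "N \<in> sets borel" "emeasure \<mu> N = 0"
  shows "((\<lambda>t. joint t E) \<longlongrightarrow> emeasure \<mu> E) at_top"
proof -
  let ?S = "{0..} \<times> {0<..} :: (ereal \<times> ereal) set" and ?K = "{0..} \<times> {ereal y..} :: (ereal \<times> ereal) set"
  have K: "compact ?K" "closed ?K" "?K \<subseteq> ?S"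
    using compact_strip[OF y] compact_imp_closed by auto
  have "top_of_set ?S closure_of E \<subseteq> ?K"
    using E(2) K by (intro closure_of_minimal) (auto intro: closed_subset)
  then have "top_of_set ?S frontier_of E \<subseteq> N"
    using fr by (auto simp: frontier_of_def)
  then have "emeasure \<mu> (top_of_set ?S frontier_of E) = 0"
    using emeasure_mono[of "top_of_set ?S frontier_of E" N \<mu>] N by simp
  moreover have "compactin (top_of_set ?S) (top_of_set ?S closure_of E)"
    using K E by (intro compactin_closure_of_subset[of ?K]) auto
  ultimately show ?thesis
    using vague E K unfolding vague_conv_def joint_def by blast
qed

lemma joint_strip_tendsto:
  assumes y: "0 < y" and "emeasure \<mu> {p. snd p = ereal y} = 0"
    and "emeasure \<mu> ({p. fst p = c} \<inter> ({0..} \<times> {ereal y..})) = 0"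
  shows "((\<lambda>t. joint t (({0..} \<inter> {c<..}) \<times> {ereal y<..})) \<longlongrightarrow>
    emeasure \<mu> (({0..} \<inter> {c<..}) \<times> {ereal y<..})) at_top"
proof (rule joint_tendsto[OF _ _ y])
  let ?N = "{p. fst p = c} \<inter> ({0..} \<times> {ereal y..}) \<union> {p. snd p = ereal y}"
  have s: "{p. fst p = c} \<in> sets (borel :: (ereal \<times> ereal) measure)"
      "{p. snd p = ereal y} \<in> sets (borel :: (ereal \<times> ereal) measure)"
    by (auto intro!: borel_closed closed_Collect_eq continuous_intros)
  then show "?N \<in> sets borel" by simp
  show "emeasure \<mu> ?N = 0"
    using null_sets.Un[OF null_setsI[OF assms(3)] null_setsI[OF assms(2)]] s by auto
  show "top_of_set ({0..} \<times> {0<..}) frontier_of (({0..} \<inter> {c<..}) \<times> {ereal y<..}) \<inter>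
      ({0..} \<times> {ereal y..}) \<subseteq> ?N"
    using frontier_of_strip[of "ereal y" c] y by auto
qed auto

section \<open>Marginals of the limit measure\<close>

text \<open>The second marginal is itself a scaling limit, of the tail of \<open>W\<close> along
  \<open>a\<close>, so \<open>ereal_tail_power_law\<close> applies to it. Consequently every cut
  height \<open>d\<close> is admissible and the discontinuity of multiplication at (0, \<infinity>)
  carries no mass.\<close>

lemma snd_atoms:
  shows snd_no_atom: "0 < y \<Longrightarrow> emeasure \<mu> {p. snd p = ereal y} = 0"
    and snd_no_top_atom: "emeasure \<mu> {p. snd p = \<infinity>} = 0"
proof -
  let ?N = "distr \<mu> borel snd"
  let ?V = "\<lambda>x. measure M {\<omega>\<in>space M. W \<omega> > ereal x}"
  have [measurable]: "snd \<in> borel_measurable \<mu>"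
    by (simp add: borel_prod[symmetric] measurable_cong_sets[OF sets_\<mu>[unfolded borel_prod[symmetric]] refl])
  have e: "emeasure ?N A = emeasure \<mu> {p. snd p \<in> A}" if "A \<in> sets borel" for A
    using that by (subst emeasure_distr) (auto simp: vimage_def)
  have meas: "{p. snd p \<in> A} \<in> sets (borel :: (ereal \<times> ereal) measure)" if "A \<in> sets borel" for A
  proof -
    have "{p. snd p \<in> A} = (UNIV :: ereal set) \<times> A" by auto
    then show ?thesis using that by (metis borel_Times sets.top space_borel)
  qed
  have e_tail: "emeasure ?N {ereal y<..} = emeasure \<mu> ({0..} \<times> {ereal y<..})" if "0 < y" for y
  proof -
    have "0 < x" if "ereal y < x" for x
      using \<open>0 < y\<close> that by (metis less_ereal.simps(1) less_trans zero_ereal_def)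
    then have "{p. snd p \<in> {ereal y<..}} \<inter> ({0..} \<times> {0<..}) = ({0..} :: ereal set) \<times> {ereal y<..}"
      by auto
    then show ?thesis
      using e[of "{ereal y<..}"] emeasure_Int_support[OF meas[of "{ereal y<..}"]] by simp
  qed
  have fin: "emeasure ?N {ereal y<..} < \<infinity>" if "0 < y" for y
    unfolding e_tail[OF that]
    by (rule le_less_trans[OF emeasure_mono emeasure_strip_finite[OF that]]) auto
  have lim: "((\<lambda>t. t * ?V (a t * y)) \<longlongrightarrow> measure ?N {ereal y<..}) at_top"
    if y: "0 < y" and "emeasure ?N {ereal y} = 0" for y
  proof -
    \<comment> \<open>The level -\<infinity> leaves the first coordinate unrestricted, so this is
      convergence for a full strip.\<close>
    have "((\<lambda>t. joint t (({0..} \<inter> {-\<infinity><..}) \<times> {ereal y<..})) \<longlongrightarrow>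
      emeasure \<mu> (({0..} \<inter> {-\<infinity><..}) \<times> {ereal y<..})) at_top"
    proof (rule joint_strip_tendsto[OF y])
      show "emeasure \<mu> {p. snd p = ereal y} = 0"
        using e[of "{ereal y}"] that by simp
      have "{p. fst p = (-\<infinity>::ereal)} \<inter> ({0..} \<times> {ereal y..}) = {}" by auto
      then show "emeasure \<mu> ({p. fst p = -\<infinity>} \<inter> ({0..} \<times> {ereal y..})) = 0" by simp
    qed
    moreover have "({0..} \<inter> {-\<infinity><..}) = ({0..} :: ereal set)"
      by (auto intro: less_le_trans[of _ 0])
    moreover have "\<forall>\<^sub>F t in at_top. joint t ({0..} \<times> {ereal y<..}) = ennreal (t * ?V (a t * y))"
      using eventually_gt_at_top[of 0]
    proof eventually_elim
      case (elim t)
      have "{\<omega>\<in>space M. (U \<omega> / ereal (\<alpha> t), W \<omega> / ereal (a t)) \<in> {0..} \<times> {ereal y<..}} =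
          {\<omega>\<in>space M. W \<omega> > ereal (a t * y)}"
      proof (intro Collect_cong conj_cong refl)
        fix \<omega> assume "\<omega> \<in> space M"
        then have "0 < U \<omega>" by (rule U_pos)
        then show "((U \<omega> / ereal (\<alpha> t), W \<omega> / ereal (a t)) \<in> {0..} \<times> {ereal y<..}) =
            (W \<omega> > ereal (a t * y))"
          using \<alpha>_pos[OF elim] a_pos[OF elim]
          by (cases "U \<omega>"; cases "W \<omega>") (auto simp: field_simps)
      qed
      then show ?case using elim by (simp add: joint_def emeasure_eq_measure ennreal_mult)
    qed
    moreover have "ennreal (measure ?N {ereal y<..}) = emeasure \<mu> ({0..} \<times> {ereal y<..})"
      using e_tail[OF y] fin[OF y] by (metis emeasure_eq_ennreal_measure infinity_ennreal_def less_top)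
    ultimately have "((\<lambda>t. ennreal (t * ?V (a t * y))) \<longlongrightarrow> ennreal (measure ?N {ereal y<..})) at_top"
      by (simp add: tendsto_cong)
    then show ?thesis
      by (rule tendsto_ennrealD) (auto intro!: eventually_mono[OF eventually_gt_at_top[of 0]])
  qed
  have V: "antimono ?V"
  proof (intro antimonoI finite_measure_mono)
    fix u v :: real assume "u \<le> v"
    then have "ereal u < x" if "ereal v < x" for x
      using that by (metis ereal_less_eq(3) le_less_trans)
    then show "{\<omega> \<in> space M. ereal v < W \<omega>} \<subseteq> {\<omega> \<in> space M. ereal u < W \<omega>}" by auto
  qed simp
  have brv: "((\<lambda>x. a (s * x) / a x) \<longlongrightarrow> s powr \<kappa>\<^sub>2) at_top" if "0 < s" for s
    using RV_a that by (simp add: RV_def)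
  have "emeasure ?N {ereal y} = 0" if "0 < y"
    by (rule ereal_tail_no_atom[OF sets_distr fin indices_pos(2) a_pos brv V lim that])
  then show "emeasure \<mu> {p. snd p = ereal y} = 0" if "0 < y"
    using that e[of "{ereal y}"] by simp
  have "emeasure ?N {\<infinity>} = 0"
    by (rule ereal_tail_no_top_atom[OF sets_distr fin indices_pos(2) a_pos brv V lim])
  then show "emeasure \<mu> {p. snd p = \<infinity>} = 0"
    using e[of "{\<infinity>}"] by simp
qed

lemma emeasure_SUP_strips:
  assumes "A \<in> sets borel"
  shows "emeasure \<mu> (A \<inter> UNIV \<times> {0<..}) =
    (SUP n. emeasure \<mu> (A \<inter> UNIV \<times> {ereal (1 / real (Suc n))<..}))"
proof -
  have "A \<inter> UNIV \<times> {0<..} = (\<Union>n. A \<inter> UNIV \<times> {ereal (1 / real (Suc n))<..})"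
  proof (intro equalityI subsetI)
    fix p :: "ereal \<times> ereal" assume p: "p \<in> A \<inter> UNIV \<times> {0<..}"
    then obtain r where r: "0 < r" "ereal r < snd p" using ereal_dense2[of 0 "snd p"] by auto
    then obtain n where "1 / real (Suc n) < r"
      using nat_approx_posE by blast
    then have "ereal (1 / real (Suc n)) < snd p" using r(2) by (metis less_ereal.simps(1) less_trans)
    then show "p \<in> (\<Union>n. A \<inter> UNIV \<times> {ereal (1 / real (Suc n))<..})"
      using p by (auto simp: mem_Times_iff)
  next
    fix p :: "ereal \<times> ereal" assume "p \<in> (\<Union>n. A \<inter> UNIV \<times> {ereal (1 / real (Suc n))<..})"
    then obtain n where n: "p \<in> A" "ereal (1 / real (Suc n)) < snd p" by auto
    have "0 < ereal (1 / real (Suc n))" by simp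
    then have "0 < snd p" using n(2) by (rule less_trans)
    then show "p \<in> A \<inter> UNIV \<times> {0<..}" using n(1) by (simp add: mem_Times_iff)
  qed
  moreover have "incseq (\<lambda>n. A \<inter> UNIV \<times> {ereal (1 / real (Suc n))<..})"
  proof (rule incseq_SucI)
    fix n
    have "ereal (1 / real (Suc (Suc n))) \<le> ereal (1 / real (Suc n))" by (simp add: field_simps)
    then show "A \<inter> UNIV \<times> {ereal (1 / real (Suc n))<..} \<subseteq> A \<inter> UNIV \<times> {ereal (1 / real (Suc (Suc n)))<..}"
      using le_less_trans by blast
  qed
  ultimately show ?thesis
    using assms by (simp add: SUP_emeasure_incseq image_subset_iff)
qed

text \<open>This transfers the moment-type condition to \<open>\<mu>\<close>: on each strip the
  limit is at most the upper limit of \<open>tailU\<close>, a bound independent of the strip, and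
  the strips exhaust the half-plane. The gap between \<open>c'\<close> and \<open>c\<close> leaves
  room for a level whose vertical line is null within the strip.\<close>

lemma fst_tail_le:
  assumes c: "0 \<le> c'" "c' < c"
  shows "emeasure \<mu> ({ereal c<..} \<times> {0<..}) \<le> Limsup at_top (tailU c')"
proof -
  have strip: "emeasure \<mu> ({ereal c<..} \<times> {ereal y<..}) \<le> Limsup at_top (tailU c')" if y: "0 < y" for y
  proof -
    let ?A = "{x. emeasure \<mu> ({p \<in> space \<mu>. fst p = x} \<inter> ({0..} \<times> {ereal y..})) \<noteq> 0}"
    have "fst \<in> borel_measurable \<mu>"
      by (simp add: borel_prod[symmetric] measurable_cong_sets[OF sets_\<mu>[unfolded borel_prod[symmetric]] refl])
    then have "countable ?A"
      using emeasure_strip_finite[OF y] by (intro countable_atoms_of_image) auto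
    moreover have "uncountable (ereal ` {c'<..<c})"
      using c by (simp add: uncountable_open_interval countable_image_inj_eq)
    ultimately have "\<not> ereal ` {c'<..<c} \<subseteq> ?A"
      using countable_subset by blast
    then obtain x where x: "c' < x" "x < c"
        "emeasure \<mu> ({p. fst p = ereal x} \<inter> ({0..} \<times> {ereal y..})) = 0"
      by auto
    let ?E = "({0..} \<inter> {ereal x<..}) \<times> {ereal y<..}"
    have "((\<lambda>t. joint t ?E) \<longlongrightarrow> emeasure \<mu> ?E) at_top"
      by (rule joint_strip_tendsto[OF y snd_no_atom[OF y] x(3)])
    then have "emeasure \<mu> ?E = Limsup at_top (\<lambda>t. joint t ?E)"
      by (simp add: lim_imp_Limsup)
    also have "\<dots> \<le> Limsup at_top (tailU c')"
    proof (intro Limsup_mono always_eventually allI)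
      fix t
      have "ereal c' < u" if "ereal x < u" for u
        using x(1) that by (metis less_ereal.simps(1) less_trans)
      then show "joint t ?E \<le> tailU c' t"
        unfolding joint_def tailU_def by (intro mult_left_mono emeasure_mono) auto
    qed
    finally have "emeasure \<mu> ?E \<le> Limsup at_top (tailU c')" .
    moreover have "emeasure \<mu> ({ereal c<..} \<times> {ereal y<..}) \<le> emeasure \<mu> ?E"
    proof (intro emeasure_mono)
      have "ereal x < u \<and> 0 \<le> u" if "ereal c < u" for u
        using x c that by (cases u) auto
      then show "{ereal c<..} \<times> {ereal y<..} \<subseteq> ?E" by auto
    qed simp
    ultimately show ?thesis by simp
  qed
  have "{ereal c<..} \<times> UNIV \<inter> UNIV \<times> B = {ereal c<..} \<times> B" for B :: "ereal set" by auto
  then have "emeasure \<mu> ({ereal c<..} \<times> {0<..}) =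
      (SUP n. emeasure \<mu> ({ereal c<..} \<times> {ereal (1 / real (Suc n))<..}))"
    using emeasure_SUP_strips[of "{ereal c<..} \<times> UNIV"] by simp
  also have "\<dots> \<le> Limsup at_top (tailU c')"
    by (intro SUP_least strip) simp
  finally show ?thesis .
qed

section \<open>The image of the limit measure under multiplication\<close>

lemma emeasure_\<nu>:
  assumes A: "A \<in> sets borel"
  shows "emeasure \<nu> A = emeasure \<mu> {p \<in> {0..} \<times> {0<..}. fst p * snd p \<in> A \<inter> {0<..}}"
proof -
  have A': "{0<..} \<inter> A \<in> sets borel" using A by simp
  have m: "{p. fst p * snd p \<in> {0<..} \<inter> A} \<in> sets (borel :: (ereal \<times> ereal) measure)"
    using measurable_sets[OF measurable_product A'] by (simp add: vimage_def)
  have "emeasure \<nu> A = emeasure (distr \<mu> borel (\<lambda>p. fst p * snd p)) ({0<..} \<inter> A)"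
    unfolding \<nu>_def using A by (intro emeasure_restricted) auto
  also have "\<dots> = emeasure \<mu> ((\<lambda>p. fst p * snd p) -` ({0<..} \<inter> A) \<inter> space \<mu>)"
    using A' measurable_product by (intro emeasure_distr) (auto simp: measurable_cong_sets[OF sets_\<mu> refl])
  also have "\<dots> = emeasure \<mu> {p. fst p * snd p \<in> {0<..} \<inter> A}"
    by (simp add: vimage_def)
  also have "\<dots> = emeasure \<mu> ({p. fst p * snd p \<in> {0<..} \<inter> A} \<inter> {0..} \<times> {0<..})"
    by (rule emeasure_Int_support[OF m])
  also have "{p. fst p * snd p \<in> {0<..} \<inter> A} \<inter> {0..} \<times> {0<..} =
      {p \<in> {0..} \<times> {0<..}. fst p * snd p \<in> A \<inter> {0<..}}" by auto
  finally show ?thesis .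
qed

lemma product_set_measurable [measurable]:
  assumes "A \<in> sets borel" "D \<in> sets borel"
  shows "{p \<in> {0..} \<times> D. fst p * snd p \<in> A} \<in> sets (borel :: (ereal \<times> ereal) measure)"
proof -
  have "{p. fst p * snd p \<in> A} \<in> sets (borel :: (ereal \<times> ereal) measure)"
    using measurable_sets[OF measurable_product assms(1)] by (simp add: vimage_def)
  then have "{0..} \<times> D \<inter> {p. fst p * snd p \<in> A} \<in> sets (borel :: (ereal \<times> ereal) measure)"
    using assms(2) by (intro sets.Int borel_Times) auto
  moreover have "{0..} \<times> D \<inter> {p. fst p * snd p \<in> A} = {p \<in> {0..} \<times> D. fst p * snd p \<in> A}" by auto
  ultimately show ?thesis by simp
qed

text \<open>The product bound gives \<open>x\<close> at least \<open>w / d\<close>; halving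
  \<open>w\<close> makes the inequality strict, as in the event defining
  \<open>tailU\<close>.\<close>

lemma ereal_product_large_imp_factor_large:
  fixes x y :: ereal
  assumes "0 \<le> x" "0 < y" "y \<le> ereal d" "ereal w \<le> x * y" "0 < d" "0 < w"
  shows "ereal ((w / 2) / d) < x"
proof (cases x)
  case (real r)
  obtain s where s: "y = ereal s" "0 < s" "s \<le> d" using assms(2,3) by (cases y) auto
  have "w \<le> r * s" using assms real s by simp
  also have "\<dots> \<le> r * d" using assms real s by (intro mult_left_mono) auto
  finally show ?thesis using assms real by (simp add: field_simps)
qed (use assms in auto)

text \<open>The cut height \<open>d\<close> takes the role of \<epsilon> in the moment-type
  condition.\<close>

lemma eventually_moment_small:
  assumes "0 < z" "0 < e"
  shows "\<forall>\<^sub>F d in at_right 0. Limsup at_top (tailU (z / d)) < e"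
  using order_tendstoD(2)[OF moment[OF assms(1)] assms(2)] by (simp add: tailU_def[abs_def])

text \<open>The preimage is covered by a compact strip and a region where x exceeds
  \<open>(w / 2) / d\<close>; the first has finite mass by the Radon property, the second by the
  moment-type condition.\<close>

lemma emeasure_\<nu>_finite:
  assumes w: "0 < w"
  shows "emeasure \<nu> {ereal w..} < \<infinity>"
proof -
  \<comment> \<open>Using \<open>w / 4\<close> here against \<open>w / 2\<close> below provides the
    strict gap between levels that \<open>fst_tail_le\<close> requires.\<close>
  have "\<forall>\<^sub>F d in at_right 0. Limsup at_top (tailU ((w / 4) / d)) < 1 \<and> 0 < d"
    using w eventually_moment_small[of "w / 4" 1] eventually_at_right_less[of 0]
    by (intro eventually_conj) auto
  then obtain d where d: "Limsup at_top (tailU ((w / 4) / d)) < 1" "0 < d"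
    using eventually_happens trivial_limit_at_right_real by blast
  let ?H = "{0..} \<times> {ereal d..} :: (ereal \<times> ereal) set"
  let ?R = "{ereal ((w / 2) / d)<..} \<times> {0<..} :: (ereal \<times> ereal) set"
  have "{p \<in> {0..} \<times> {0<..}. fst p * snd p \<in> {ereal w..} \<inter> {0<..}} \<subseteq> ?H \<union> ?R"
  proof
    fix p :: "ereal \<times> ereal" assume p: "p \<in> {p \<in> {0..} \<times> {0<..}. fst p * snd p \<in> {ereal w..} \<inter> {0<..}}"
    show "p \<in> ?H \<union> ?R"
    proof (cases "ereal d \<le> snd p")
      case True
      then show ?thesis using p by (simp add: mem_Times_iff)
    next
      case False
      then have "ereal ((w / 2) / d) < fst p"
        using p w d(2) by (intro ereal_product_large_imp_factor_large[of _ "snd p"]) (auto simp: mem_Times_iff)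
      then show ?thesis using p by (simp add: mem_Times_iff)
    qed
  qed
  then have "emeasure \<nu> {ereal w..} \<le> emeasure \<mu> (?H \<union> ?R)"
    unfolding emeasure_\<nu>[OF borel_closed[OF closed_atLeast]] by (intro emeasure_mono) auto
  also have "\<dots> \<le> emeasure \<mu> ?H + emeasure \<mu> ?R"
    by (intro emeasure_subadditive) auto
  also have "\<dots> < \<infinity>"
  proof -
    have "emeasure \<mu> ?R \<le> Limsup at_top (tailU ((w / 4) / d))"
      using w d by (intro fst_tail_le) (auto simp: field_simps)
    then have "emeasure \<mu> ?R < \<infinity>"
      using d(1) by (metis ennreal_one_less_top infinity_ennreal_def le_less_trans less_trans)
    then show ?thesis using emeasure_strip_finite[OF d(2)] by simp
  qed
  finally show ?thesis .
qed

section \<open>Convergence of the law of the scaled product\<close>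

lemma scaled_product:
  assumes "0 < t" "\<omega> \<in> space M"
  shows "U \<omega> * W \<omega> / ereal (\<alpha> t * a t) = (U \<omega> / ereal (\<alpha> t)) * (W \<omega> / ereal (a t))"
    and "0 < U \<omega> / ereal (\<alpha> t)" and "0 < W \<omega> / ereal (a t)"
  using U_pos[OF assms(2)] W_pos[OF assms(2)] \<alpha>_pos[OF assms(1)] a_pos[OF assms(1)]
  by (cases "U \<omega>"; cases "W \<omega>"; auto)+

lemma scaled_measurable [measurable]:
  assumes "B \<in> sets borel"
  shows "{\<omega>\<in>space M. (U \<omega> / ereal (\<alpha> t), W \<omega> / ereal (a t)) \<in> B} \<in> sets M"
proof -
  have "(\<lambda>\<omega>. (U \<omega> / ereal (\<alpha> t), W \<omega> / ereal (a t))) \<in> borel_measurable M"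
    by (intro borel_measurable_Pair) measurable
  from measurable_sets[OF this assms] show ?thesis
    by (simp add: vimage_def Int_def conj_commute)
qed

lemma product_measurable [measurable]:
  assumes "B \<in> sets borel"
  shows "{\<omega>\<in>space M. U \<omega> * W \<omega> / ereal c \<in> B} \<in> sets M"
  using assms by measurable

definition prodlaw :: "real \<Rightarrow> ereal set \<Rightarrow> ennreal" where
  "prodlaw t B = ennreal t * emeasure M {\<omega>\<in>space M. U \<omega> * W \<omega> / ereal (\<alpha> t * a t) \<in> B}"

text \<open>For each cut height, \<open>prodlaw t B\<close> lies between
  \<open>joint t (E d)\<close> and the same quantity plus \<open>tailU ((w / 2) / d) t\<close>. The
  first converges to the mass of \<open>E d\<close>, which increases to that of \<open>B\<close>
  under \<open>\<nu>\<close> as \<open>d\<close> decreases to 0, while the upper limit of the added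
  term vanishes.\<close>

lemma prodlaw_tendsto:
  assumes B: "B \<in> sets borel" "B \<subseteq> {ereal w..}" and w: "0 < w"
    and fr: "emeasure \<nu> (top_of_set {0<..} frontier_of B) = 0"
  shows "((\<lambda>t. prodlaw t B) \<longlongrightarrow> emeasure \<nu> B) at_top"
proof -
  define E where "E d = {p \<in> {0..} \<times> {ereal d<..}. fst p * snd p \<in> B}" for d
  have Bpos: "B \<subseteq> {0<..}"
  proof
    fix x assume "x \<in> B"
    then have "ereal w \<le> x" using B(2) by auto
    then show "x \<in> {0<..}" using w by (cases x) auto
  qed
  have E_meas: "E d \<in> sets borel" for d
    unfolding E_def using B(1) by (intro product_set_measurable) auto
  have E_lim: "((\<lambda>t. joint t (E d)) \<longlongrightarrow> emeasure \<mu> (E d)) at_top" if d: "0 < d" for d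
  proof (rule joint_tendsto[OF E_meas _ d])
    let ?F = "top_of_set {0<..} frontier_of B"
    have F: "?F \<in> sets borel"
    proof -
      have "?F = {0<..} \<inter> frontier B"
        by (subst frontier_of_subtopology_open) (auto simp: frontier_of_def frontier_def)
      then show ?thesis by simp
    qed
    \<comment> \<open>The first piece is null because its \<open>\<mu>\<close>-mass is the
      \<open>\<nu>\<close>-mass of the frontier of \<open>B\<close>; the two lines are null by the
      power law of the second marginal.\<close>
    let ?N = "{p \<in> {0..} \<times> {0<..}. fst p * snd p \<in> ?F \<inter> {0<..}} \<union> ({p. snd p = ereal d} \<union> {p. snd p = \<infinity>})"
    have N1: "{p \<in> {0..} \<times> {0<..}. fst p * snd p \<in> ?F \<inter> {0<..}} \<in> null_sets \<mu>"
      using fr F by (intro null_setsI) (auto simp: emeasure_\<nu>)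
    have s: "{p. snd p = c} \<in> sets \<mu>" for c
      by (auto intro!: borel_closed closed_Collect_eq continuous_intros)
    have N2: "{p. snd p = ereal d} \<in> null_sets \<mu>" "{p. snd p = \<infinity>} \<in> null_sets \<mu>"
      by (rule null_setsI[OF snd_no_atom[OF d] s] null_setsI[OF snd_no_top_atom s])+
    have "?N \<in> null_sets \<mu>"
      using N1 N2 by (intro null_sets.Un)
    then show "?N \<in> sets borel" "emeasure \<mu> ?N = 0" by (auto dest: null_setsD1 null_setsD2)
    have "?F \<subseteq> {0<..}" using frontier_of_subset_topspace[of "top_of_set {0<..}" B] by simp
    moreover have "top_of_set ({0..} \<times> {0<..}) frontier_of E d \<subseteq>
        {p. fst p * snd p \<in> ?F} \<union> {p. snd p = ereal d} \<union> {p. snd p = \<infinity>}"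
      unfolding E_def using w d by (intro frontier_of_product_set[OF B(2)]) auto
    ultimately show "top_of_set ({0..} \<times> {0<..}) frontier_of E d \<inter> ({0..} \<times> {ereal d..}) \<subseteq> ?N"
      using compact_strip(2)[OF d] by blast
  qed (auto simp: E_def)
  have E_le: "emeasure \<mu> (E d) \<le> emeasure \<nu> B" if "0 < d" for d
  proof -
    have "0 < y" if "ereal d < y" for y using that \<open>0 < d\<close> by (cases y) auto
    then have "E d \<subseteq> {p \<in> {0..} \<times> {0<..}. fst p * snd p \<in> B \<inter> {0<..}}"
      using Bpos by (auto simp: E_def)
    then show ?thesis
      unfolding emeasure_\<nu>[OF B(1)] using B(1) by (intro emeasure_mono) auto
  qed
  have SUP: "emeasure \<nu> B = (SUP n. emeasure \<mu> (E (1 / real (Suc n))))"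
  proof -
    let ?A = "{p \<in> {0..} \<times> UNIV. fst p * snd p \<in> B}"
    have "?A \<in> sets borel" using B(1) by (intro product_set_measurable) auto
    from emeasure_SUP_strips[OF this]
    have "emeasure \<mu> (?A \<inter> UNIV \<times> {0<..}) =
      (SUP n. emeasure \<mu> (?A \<inter> UNIV \<times> {ereal (1 / real (Suc n))<..}))" .
    moreover have "?A \<inter> UNIV \<times> {0<..} = {p \<in> {0..} \<times> {0<..}. fst p * snd p \<in> B \<inter> {0<..}}"
      using Bpos by auto
    moreover have "?A \<inter> UNIV \<times> {ereal d<..} = E d" for d by (auto simp: E_def)
    ultimately show ?thesis using emeasure_\<nu>[OF B(1)] by simp
  qed
  have lower: "joint t (E d) \<le> prodlaw t B" if "0 < t" for t d
    unfolding joint_def prodlaw_def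
    using scaled_product(1)[OF that] B(1) by (intro mult_left_mono emeasure_mono) (auto simp: E_def)
  have upper: "prodlaw t B \<le> joint t (E d) + tailU ((w / 2) / d) t" if t: "0 < t" and d: "0 < d" for t d
  proof -
    let ?J = "{\<omega>\<in>space M. (U \<omega> / ereal (\<alpha> t), W \<omega> / ereal (a t)) \<in> E d}"
    let ?T = "{\<omega>\<in>space M. U \<omega> / ereal (\<alpha> t) > ereal ((w / 2) / d)}"
    have "{\<omega>\<in>space M. U \<omega> * W \<omega> / ereal (\<alpha> t * a t) \<in> B} \<subseteq> ?J \<union> ?T"
    proof
      fix \<omega> assume \<omega>: "\<omega> \<in> {\<omega>\<in>space M. U \<omega> * W \<omega> / ereal (\<alpha> t * a t) \<in> B}"
      let ?u = "U \<omega> / ereal (\<alpha> t)" and ?v = "W \<omega> / ereal (a t)"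
      from \<omega> have sp: "\<omega> \<in> space M" and uvB: "?u * ?v \<in> B" using scaled_product(1)[OF t] by auto
      note pos = scaled_product(2,3)[OF t sp]
      show "\<omega> \<in> ?J \<union> ?T"
      proof (cases "ereal d < ?v")
        case True
        then show ?thesis using sp uvB pos by (auto simp: E_def)
      next
        case False
        then have "ereal ((w / 2) / d) < ?u"
          using pos uvB B(2) d w by (intro ereal_product_large_imp_factor_large[of _ ?v]) auto
        then show ?thesis using sp by auto
      qed
    qed
    then have "emeasure M {\<omega>\<in>space M. U \<omega> * W \<omega> / ereal (\<alpha> t * a t) \<in> B} \<le> emeasure M (?J \<union> ?T)"
      using E_meas by (intro emeasure_mono sets.Un scaled_measurable) auto
    also have "\<dots> \<le> emeasure M ?J + emeasure M ?T"
      using E_meas by (intro emeasure_subadditive scaled_measurable) auto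
    finally show ?thesis
      unfolding prodlaw_def joint_def tailU_def distrib_left[symmetric] by (rule mult_left_mono) simp
  qed
  show ?thesis
  proof (rule order_tendstoI)
    fix v assume "v < emeasure \<nu> B"
    then obtain n where "v < emeasure \<mu> (E (1 / real (Suc n)))"
      unfolding SUP by (auto simp: less_SUP_iff)
    then have "\<forall>\<^sub>F t in at_top. v < joint t (E (1 / real (Suc n)))"
      by (intro order_tendstoD(1)[OF E_lim]) auto
    then show "\<forall>\<^sub>F t in at_top. v < prodlaw t B"
      using eventually_gt_at_top[of 0] by eventually_elim (blast intro: less_le_trans lower)
  next
    fix v assume "emeasure \<nu> B < v"
    \<comment> \<open>The slack is split: the truncated part is kept below \<open>v'\<close> and the
      remainder below \<open>v - v'\<close>. Since \<open>v'\<close> is finite, the subtraction can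
      be undone even if \<open>v\<close> is \<infinity>.\<close>
    then obtain v' where v': "emeasure \<nu> B < v'" "v' < v" using dense by blast
    then have "0 < v - v'" by (simp add: diff_gt_0_iff_gt_ennreal)
    then have "\<forall>\<^sub>F d in at_right 0. Limsup at_top (tailU ((w / 2) / d)) < v - v' \<and> 0 < d"
      using w eventually_moment_small[of "w / 2"] eventually_at_right_less[of 0]
      by (intro eventually_conj) auto
    then obtain d where d: "Limsup at_top (tailU ((w / 2) / d)) < v - v'" "0 < d"
      using eventually_happens trivial_limit_at_right_real by blast
    have "\<forall>\<^sub>F t in at_top. joint t (E d) < v'"
      using E_le[OF d(2)] v' by (intro order_tendstoD(2)[OF E_lim[OF d(2)]]) auto
    moreover have "\<forall>\<^sub>F t in at_top. tailU ((w / 2) / d) t < v - v'"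
      by (rule Limsup_lessD[OF d(1)])
    ultimately show "\<forall>\<^sub>F t in at_top. prodlaw t B < v"
      using eventually_gt_at_top[of 0]
    proof eventually_elim
      case (elim t)
      have "v' < top" using v'(2) by (rule less_le_trans) simp
      then have "tailU ((w / 2) / d) t + v' < v"
        using elim(2) by (simp add: less_diff_eq_ennreal)
      moreover have "prodlaw t B \<le> v' + tailU ((w / 2) / d) t"
        by (rule order.trans[OF upper[OF elim(3) d(2)] add_right_mono[OF less_imp_le[OF elim(1)]]])
      ultimately show ?case by (simp add: add.commute)
    qed
  qed
qed

section \<open>Power law and regular variation of the product tail\<close>

definition tail :: "real \<Rightarrow> real" where
  "tail x = measure M {\<omega>\<in>space M. U \<omega> * W \<omega> > ereal x}"

lemma antimono_tail: "antimono tail"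
  unfolding tail_def
proof (intro antimonoI finite_measure_mono)
  fix u v :: real assume "u \<le> v"
  then have "ereal u < x" if "ereal v < x" for x
    using that by (metis ereal_less_eq(3) le_less_trans)
  then show "{\<omega> \<in> space M. ereal v < U \<omega> * W \<omega>} \<subseteq> {\<omega> \<in> space M. ereal u < U \<omega> * W \<omega>}" by auto
qed measurable

lemma scale_regularly_varying:
  assumes "0 < s"
  shows "((\<lambda>t. \<alpha> (s * t) * a (s * t) / (\<alpha> t * a t)) \<longlongrightarrow> s powr (\<kappa>\<^sub>1 + \<kappa>\<^sub>2)) at_top"
proof -
  have "((\<lambda>t. (\<alpha> (s * t) / \<alpha> t) * (a (s * t) / a t)) \<longlongrightarrow> s powr \<kappa>\<^sub>1 * s powr \<kappa>\<^sub>2) at_top"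
    using RV_\<alpha> RV_a assms by (intro tendsto_mult) (auto simp: RV_def)
  then show ?thesis by (simp add: powr_add)
qed

lemma scale_pos: "0 < t \<Longrightarrow> 0 < \<alpha> t * a t"
  by (simp add: \<alpha>_pos a_pos)

lemma \<nu>_tail_finite: "0 < w \<Longrightarrow> emeasure \<nu> {ereal w<..} < \<infinity>"
  by (rule le_less_trans[OF emeasure_mono emeasure_\<nu>_finite]) auto

text \<open>The point \<infinity> is interior to \<open>{ereal w<..}\<close>, so the frontier of
  this set consists at most of \<open>w\<close>.\<close>

lemma tail_tendsto_if_no_atom:
  assumes w: "0 < w" and "emeasure \<nu> {ereal w} = 0"
  shows "((\<lambda>t. t * tail (\<alpha> t * a t * w)) \<longlongrightarrow> measure \<nu> {ereal w<..}) at_top"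
proof -
  have "top_of_set {0<..} frontier_of {ereal w<..} \<subseteq> {ereal w}"
  proof (rule frontier_of_subset_if_locally_constant)
    fix p assume "p \<notin> {ereal w}"
    then have "p < ereal w \<or> ereal w < p" by auto
    then show "\<exists>T. open T \<and> p \<in> T \<and> ({0<..} \<inter> T \<inter> {ereal w<..} = {} \<or> {0<..} \<inter> T \<subseteq> {ereal w<..})"
    proof
      assume "p < ereal w"
      then show ?thesis by (intro exI[of _ "{..<ereal w}"]) auto
    next
      assume "ereal w < p"
      then show ?thesis by (intro exI[of _ "{ereal w<..}"]) auto
    qed
  qed
  then have "emeasure \<nu> (top_of_set {0<..} frontier_of {ereal w<..}) \<le> emeasure \<nu> {ereal w}"
    by (intro emeasure_mono) auto
  then have "emeasure \<nu> (top_of_set {0<..} frontier_of {ereal w<..}) = 0"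
    using assms(2) by simp
  then have "((\<lambda>t. prodlaw t {ereal w<..}) \<longlongrightarrow> emeasure \<nu> {ereal w<..}) at_top"
    using w by (intro prodlaw_tendsto[of _ w]) auto
  moreover have "\<forall>\<^sub>F t in at_top. prodlaw t {ereal w<..} = ennreal (t * tail (\<alpha> t * a t * w))"
    using eventually_gt_at_top[of 0]
  proof eventually_elim
    case (elim t)
    have "(z / ereal (\<alpha> t * a t) \<in> {ereal w<..}) = (z > ereal (\<alpha> t * a t * w))" for z
      using scale_pos[OF elim] by (cases z) (auto simp: field_simps)
    then show ?case using elim by (simp add: prodlaw_def tail_def emeasure_eq_measure ennreal_mult)
  qed
  moreover have "ennreal (measure \<nu> {ereal w<..}) = emeasure \<nu> {ereal w<..}"
    using \<nu>_tail_finite[OF w] by (metis emeasure_eq_ennreal_measure infinity_ennreal_def less_top)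
  ultimately have "((\<lambda>t. ennreal (t * tail (\<alpha> t * a t * w))) \<longlongrightarrow> ennreal (measure \<nu> {ereal w<..})) at_top"
    by (simp add: tendsto_cong)
  then show ?thesis
    by (rule tendsto_ennrealD)
      (auto intro!: eventually_mono[OF eventually_gt_at_top[of 0]] simp: tail_def)
qed

text \<open>This and the next two facts are \<open>ereal_tail_power_law\<close> for
  \<open>\<nu>\<close> along the scale \<open>\<alpha> t * a t\<close>, whose index is
  \<open>\<kappa>\<^sub>1 + \<kappa>\<^sub>2\<close>.\<close>

lemma \<nu>_no_atom: "0 < w \<Longrightarrow> emeasure \<nu> {ereal w} = 0"
  by (rule ereal_tail_no_atom[OF sets_\<nu> \<nu>_tail_finite add_pos_pos[OF indices_pos] scale_pos
    scale_regularly_varying antimono_tail tail_tendsto_if_no_atom])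

lemma \<nu>_no_top_atom: "emeasure \<nu> {\<infinity>} = 0"
  by (rule ereal_tail_no_top_atom[OF sets_\<nu> \<nu>_tail_finite add_pos_pos[OF indices_pos] scale_pos
    scale_regularly_varying antimono_tail tail_tendsto_if_no_atom])

lemma \<nu>_tail: "0 < w \<Longrightarrow> measure \<nu> {ereal w<..} = measure \<nu> {1<..} * w powr (- 1 / (\<kappa>\<^sub>1 + \<kappa>\<^sub>2))"
  by (rule ereal_tail_power[OF sets_\<nu> \<nu>_tail_finite add_pos_pos[OF indices_pos] scale_pos
    scale_regularly_varying antimono_tail tail_tendsto_if_no_atom])

lemma tail_tendsto:
  "0 < w \<Longrightarrow> ((\<lambda>t. t * tail (\<alpha> t * a t * w)) \<longlongrightarrow>
    measure \<nu> {1<..} * w powr (- (1 / (\<kappa>\<^sub>1 + \<kappa>\<^sub>2)))) at_top"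
  using tail_tendsto_if_no_atom[OF _ \<nu>_no_atom, of w] by (simp add: \<nu>_tail)

text \<open>If the constant of the power law vanished, so would every tail and hence all of
  \<open>\<nu>\<close>. Then \<open>\<mu>\<close> would have no mass on x > 0, y > 1, and its
  distribution function for y = 1 would be constant in x.\<close>

lemma \<nu>_tail_pos: "0 < measure \<nu> {1<..}"
proof (rule ccontr)
  assume "\<not> 0 < measure \<nu> {1<..}"
  then have z: "measure \<nu> {1<..} = 0" by (simp add: not_less measure_le_0_iff)
  have "emeasure \<nu> {ereal (1 / real (Suc n))<..} = 0" for n
    using \<nu>_tail[of "1 / real (Suc n)"] z \<nu>_tail_finite[of "1 / real (Suc n)"]
    by (simp add: emeasure_eq_ennreal_measure less_top)
  then have null: "(\<Union>n. {ereal (1 / real (Suc n))<..}) \<in> null_sets \<nu>"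
    by (intro null_sets_UN null_setsI) auto
  have "{0<..} \<subseteq> (\<Union>n. {ereal (1 / real (Suc n))<..})"
  proof
    fix x :: ereal assume "x \<in> {0<..}"
    then obtain r where r: "0 < r" "ereal r < x" using ereal_dense2[of 0 x] by auto
    then obtain n where "1 / real (Suc n) < r"
      using nat_approx_posE by blast
    then have "ereal (1 / real (Suc n)) < x" using r(2) by (metis less_ereal.simps(1) less_trans)
    then show "x \<in> (\<Union>n. {ereal (1 / real (Suc n))<..})" by blast
  qed
  then have "{0<..} \<in> null_sets \<nu>"
    by (intro null_sets_subset[OF null]) auto
  then have 0: "emeasure \<mu> {p \<in> {0..} \<times> {0<..}. fst p * snd p \<in> {0<..} \<inter> {0<..}} = 0"
    using emeasure_\<nu>[of "{0<..}"] null_setsD1 by fastforce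
  have "{0<..} \<times> {1<..} \<subseteq> {p \<in> {0..} \<times> {0<..}. fst p * snd p \<in> {0<..} \<inter> ({0<..} :: ereal set)}"
  proof
    fix p :: "ereal \<times> ereal" assume "p \<in> {0<..} \<times> {1<..}"
    then have "0 < fst p" "1 < snd p" by (auto simp: mem_Times_iff)
    then have "0 < fst p" "0 < snd p" using less_trans[of 0 1 "snd p"] by auto
    then show "p \<in> {p \<in> {0..} \<times> {0<..}. fst p * snd p \<in> {0<..} \<inter> {0<..}}"
      by (simp add: mem_Times_iff less_imp_le ereal_zero_less_0_iff)
  qed
  then have "emeasure \<mu> ({0<..} \<times> {1<..}) \<le> 0"
    unfolding 0[symmetric] by (intro emeasure_mono) auto
  then have n: "emeasure \<mu> ({0<..} \<times> {1<..}) = 0" by simp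
  have const: "emeasure \<mu> ({0..ereal x} \<times> {ereal 1<..}) = emeasure \<mu> ({0..ereal 0} \<times> {ereal 1<..})" if "0 \<le> x" for x
  proof (rule antisym)
    have "emeasure \<mu> ({0..ereal x} \<times> {ereal 1<..}) \<le> emeasure \<mu> ({0..ereal 0} \<times> {ereal 1<..} \<union> {0<..} \<times> {1<..})"
      by (intro emeasure_mono) (auto simp: one_ereal_def)
    also have "\<dots> \<le> emeasure \<mu> ({0..ereal 0} \<times> {ereal 1<..}) + emeasure \<mu> ({0<..} \<times> {1<..})"
      by (intro emeasure_subadditive) auto
    finally show "emeasure \<mu> ({0..ereal x} \<times> {ereal 1<..}) \<le> emeasure \<mu> ({0..ereal 0} \<times> {ereal 1<..})"
      using n by simp
    have "y \<le> ereal x" if "y \<le> ereal 0" for y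
      using order_trans[OF that, of "ereal x"] \<open>0 \<le> x\<close> by simp
    then show "emeasure \<mu> ({0..ereal 0} \<times> {ereal 1<..}) \<le> emeasure \<mu> ({0..ereal x} \<times> {ereal 1<..})"
      by (intro emeasure_mono) auto
  qed
  \<comment> \<open>A function constant on the half-line is degenerate, with its single jump placed
    at 0.\<close>
  have "\<exists>b c. \<forall>x\<ge>0. emeasure \<mu> ({0..ereal x} \<times> {ereal 1<..}) = (if b \<le> x then c else 0)"
  proof (intro exI allI impI)
    fix x :: real assume x: "0 \<le> x"
    show "emeasure \<mu> ({0..ereal x} \<times> {ereal 1<..}) =
        (if 0 \<le> x then emeasure \<mu> ({0..ereal 0} \<times> {ereal 1<..}) else 0)"
      unfolding if_P[OF x] by (rule const[OF x])
  qed
  moreover have "\<not> (\<exists>b c. \<forall>x\<ge>0. emeasure \<mu> ({0..ereal x} \<times> {ereal 1<..}) = (if b \<le> x then c else 0))"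
    using nondeg[OF zero_less_one] unfolding nondeg_df_def by (elim conjE)
  ultimately show False by (rule notE[rotated])
qed

lemma tail_pos: "0 < tail x"
proof (rule ccontr)
  assume "\<not> 0 < tail x"
  then have x: "tail x = 0" by (simp add: tail_def not_less measure_le_0_iff)
  define b where "b t = \<alpha> t * a t" for t
  text \<open>A vanishing tail would bound \<open>b\<close>, whereas regular variation of positive index makes \<open>b\<close>
    grow geometrically along \<open>2 ^ n * t\<close>.\<close>
  have "\<forall>\<^sub>F t in at_top. 0 < t * tail (b t * 1)"
    using order_tendstoD(1)[OF tail_tendsto[of 1], of 0] \<nu>_tail_pos by (simp add: b_def)
  then have "\<forall>\<^sub>F t in at_top. b t < x"
  proof eventually_elim
    case (elim t)
    show ?case
    proof (rule ccontr)
      assume "\<not> b t < x"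
      then have "tail (b t) \<le> 0" using antimonoD[OF antimono_tail, of x "b t"] x by simp
      then have "tail (b t) = 0" by (simp add: tail_def measure_le_0_iff)
      then show False using elim by simp
    qed
  qed
  \<comment> \<open>The square root of the limiting ratio of \<open>b\<close> under doubling:
    strictly above 1, yet strictly below that ratio.\<close>
  moreover define c where "c = 2 powr ((\<kappa>\<^sub>1 + \<kappa>\<^sub>2) / 2)"
  have c: "1 < c" "c < 2 powr (\<kappa>\<^sub>1 + \<kappa>\<^sub>2)"
    using indices_pos by (auto simp: c_def)
  have "\<forall>\<^sub>F t in at_top. c < b (2 * t) / b t"
    using order_tendstoD(1)[OF scale_regularly_varying[of 2] c(2)] by (simp add: b_def)
  ultimately have "\<forall>\<^sub>F t in at_top. b t < x \<and> c < b (2 * t) / b t \<and> 0 < t"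
    using eventually_gt_at_top[of 0] by eventually_elim auto
  then obtain t where t: "\<And>s. t \<le> s \<Longrightarrow> b s < x \<and> c < b (2 * s) / b s \<and> 0 < s"
    unfolding eventually_at_top_linorder by blast
  have t0: "0 < t" "0 < b t" using t[of t] scale_pos by (auto simp: b_def)
  have ge: "t \<le> 2 ^ n * t" for n :: nat using t0 by simp
  have "c ^ n * b t \<le> b (2 ^ n * t)" for n
  proof (induction n)
    case (Suc n)
    have "0 < b (2 ^ n * t)" using t0 scale_pos by (simp add: b_def)
    then have "c * b (2 ^ n * t) \<le> b (2 * (2 ^ n * t))"
      using t[OF ge[of n]] by (simp add: field_simps)
    moreover have "c * (c ^ n * b t) \<le> c * b (2 ^ n * t)"
      using Suc c by (intro mult_left_mono) auto
    ultimately show ?case by (simp add: mult.assoc)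
  qed simp
  then have bounded: "c ^ n * b t < x" for n using t[OF ge[of n]] le_less_trans by blast
  obtain n where "x / b t < c ^ n" using real_arch_pow[OF c(1)] by blast
  then show False using bounded[of n] t0 by (simp add: field_simps)
qed

text \<open>By continuity from above the tail decreases to the probability that the product is
  \<infinity>. A positive such probability would make \<open>t * tail (\<alpha> t * a t)\<close>
  diverge, although it has a finite limit.\<close>

lemma tail_tendsto_0: "(tail \<longlongrightarrow> 0) at_top"
proof -
  have inf: "measure M {\<omega>\<in>space M. U \<omega> * W \<omega> = \<infinity>} = 0"
  proof (rule ccontr)
    let ?q = "measure M {\<omega>\<in>space M. U \<omega> * W \<omega> = \<infinity>}"
    assume "?q \<noteq> 0"
    then have "0 < ?q" by (simp add: zero_less_measure_iff)
    then have "filterlim (\<lambda>t. t * ?q) at_top at_top"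
      by (intro filterlim_at_top_mult_tendsto_pos[OF tendsto_const] filterlim_ident)
    moreover have "\<forall>\<^sub>F t in at_top. t * ?q \<le> t * tail (\<alpha> t * a t * 1)"
      using eventually_gt_at_top[of 0]
      by eventually_elim (auto simp: tail_def intro!: mult_left_mono finite_measure_mono)
    ultimately have "filterlim (\<lambda>t. t * tail (\<alpha> t * a t * 1)) at_top at_top"
      by (rule filterlim_at_top_mono)
    then show False
      using tail_tendsto[of 1] not_tendsto_and_filterlim_at_infinity[OF trivial_limit_at_top_linorder]
        filterlim_at_top_imp_at_infinity by fastforce
  qed
  have "(\<lambda>n. tail (real n)) \<longlonglongrightarrow> measure M (\<Inter>n. {\<omega>\<in>space M. U \<omega> * W \<omega> > ereal (real n)})"
    unfolding tail_def
  proof (rule finite_Lim_measure_decseq)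
    show "decseq (\<lambda>n. {\<omega>\<in>space M. U \<omega> * W \<omega> > ereal (real n)})"
    proof (rule decseq_SucI)
      fix n
      have "ereal (real n) < x" if "ereal (real (Suc n)) < x" for x
        using that by (cases x) auto
      then show "{\<omega>\<in>space M. U \<omega> * W \<omega> > ereal (real (Suc n))} \<subseteq> {\<omega>\<in>space M. U \<omega> * W \<omega> > ereal (real n)}"
        by blast
    qed
  qed auto
  also have "(\<Inter>n. {\<omega>\<in>space M. U \<omega> * W \<omega> > ereal (real n)}) = {\<omega>\<in>space M. U \<omega> * W \<omega> = \<infinity>}"
  proof -
    have iff: "(\<forall>n. ereal (real n) < x) = (x = \<infinity>)" for x
    proof
      assume x: "\<forall>n. ereal (real n) < x"
      show "x = \<infinity>"
      proof (cases x)
        case (real r)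
        obtain n :: nat where "r < real n" using reals_Archimedean2 by blast
        then show ?thesis using spec[OF x, of n] real by simp
      qed (use x in auto)
    qed simp
    have "(\<Inter>n. {\<omega>\<in>space M. U \<omega> * W \<omega> > ereal (real n)}) =
        {\<omega>\<in>space M. \<forall>n. ereal (real n) < U \<omega> * W \<omega>}" by auto
    then show ?thesis unfolding iff .
  qed
  finally have lim: "(\<lambda>n. tail (real n)) \<longlonglongrightarrow> 0" using inf by simp
  show ?thesis
  proof (rule order_tendstoI)
    fix e :: real assume "0 < e"
    then obtain n where "tail (real n) < e"
      using order_tendstoD(2)[OF lim] by (auto simp: eventually_sequentially)
    then have "tail x < e" if "real n \<le> x" for x
      using antimonoD[OF antimono_tail that] by simp
    then show "\<forall>\<^sub>F x in at_top. tail x < e"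
      using eventually_ge_at_top[of "real n"] by (rule eventually_mono[rotated])
  qed (auto intro!: always_eventually less_trans[OF _ tail_pos])
qed

lemma RV_product_tail: "RV (- 1 / (\<kappa>\<^sub>1 + \<kappa>\<^sub>2)) tail"
  unfolding RV_def
proof (intro conjI allI impI)
  show "0 < tail x" for x by (rule tail_pos)
  have "mono (\<lambda>x. - tail x)" using antimono_tail by (auto simp: mono_def antimono_def)
  then have "(\<lambda>x. - (- tail x)) \<in> borel_measurable borel"
    by (intro borel_measurable_uminus borel_measurable_mono)
  then show "tail \<in> borel_measurable (restrict_space borel {0<..})"
    by (intro measurable_restrict_space1) simp
  show "((\<lambda>x. tail (t * x) / tail x) \<longlongrightarrow> t powr (- 1 / (\<kappa>\<^sub>1 + \<kappa>\<^sub>2))) at_top" if "0 < t" for t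
    using regular_variation_of_scaling_limit[OF antimono_tail tail_pos tail_tendsto_0 \<nu>_tail_pos _
        scale_pos tail_tendsto that] indices_pos
    by simp
qed

section \<open>Properties of the limit measure on (0, \<infinity>]\<close>

lemma radon_\<nu>: "radon_on {0<..} \<nu>"
  unfolding radon_on_def
proof (intro conjI allI impI)
  have "{p \<in> {0..} \<times> {0<..}. fst p * snd p \<in> (UNIV - {0<..}) \<inter> {0<..}} = {}" by auto
  then show "emeasure \<nu> (UNIV - {0<..}) = 0"
    by (subst emeasure_\<nu>) auto
  fix K :: "ereal set" assume "compactin (top_of_set {0<..}) K"
  then have "compact K" "K \<subseteq> {0<..}" by (auto simp: compactin_subtopology)
  then obtain w where w: "0 < w" "K \<subseteq> {ereal w..}" using compact_pos_ereal_lower_bound by blast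
  then show "emeasure \<nu> K < \<infinity>"
    by (intro le_less_trans[OF emeasure_mono emeasure_\<nu>_finite[OF w(1)]]) auto
qed simp

text \<open>There is positive mass but no atom in (0, \<infinity>], so removing one point cannot
  leave a null set; a point \<open>p \<le> 0\<close> removes nothing.\<close>

lemma nondegenerate_\<nu>: "nondegenerate_measure {0<..} \<nu>"
  unfolding nondegenerate_measure_def
proof
  assume "\<exists>p. emeasure \<nu> ({0<..} - {p}) = 0"
  then obtain p where p: "emeasure \<nu> ({0<..} - {p}) = 0" by blast
  have "emeasure \<nu> {p} = 0 \<or> p \<le> 0"
    using \<nu>_no_atom \<nu>_no_top_atom by (cases p) (auto simp: not_le)
  then have "emeasure \<nu> {0<..} = 0"
  proof
    assume "emeasure \<nu> {p} = 0"
    then have "({0<..} - {p}) \<union> {p} \<in> null_sets \<nu>"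
      using p by (intro null_sets.Un null_setsI) auto
    then have "{0<..} \<in> null_sets \<nu>" by (rule null_sets_subset) auto
    then show ?thesis by auto
  next
    assume "p \<le> 0"
    then have "{0<..} - {p} = {0<..}" by auto
    then show ?thesis using p by simp
  qed
  moreover have "{1<..} \<subseteq> ({0<..} :: ereal set)"
    using less_trans[of 0 "1::ereal"] by auto
  then have "emeasure \<nu> {1<..} \<le> emeasure \<nu> {0<..}"
    by (intro emeasure_mono) auto
  ultimately show False using \<nu>_tail_pos by (simp add: measure_def)
qed

text \<open>Relative compactness keeps the test set above some \<open>w > 0\<close>, which is the
  situation of \<open>prodlaw_tendsto\<close>.\<close>

lemma product_vague_conv:
  "vague_conv {0<..}
    (\<lambda>t B. ennreal t * emeasure M {\<omega>\<in>space M. U \<omega> * W \<omega> / ereal (\<alpha> t * a t) \<in> B}) \<nu>"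
  unfolding vague_conv_def prodlaw_def[symmetric]
proof (intro allI impI, elim conjE)
  fix B :: "ereal set"
  assume B: "B \<in> sets borel" "B \<subseteq> {0<..}"
    and c: "compactin (top_of_set {0<..}) (top_of_set {0<..} closure_of B)"
    and f: "emeasure \<nu> (top_of_set {0<..} frontier_of B) = 0"
  have "compact (top_of_set {0<..} closure_of B)" "top_of_set {0<..} closure_of B \<subseteq> {0<..}"
    using c by (auto simp: compactin_subtopology)
  then obtain w where w: "0 < w" "top_of_set {0<..} closure_of B \<subseteq> {ereal w..}"
    using compact_pos_ereal_lower_bound by blast
  moreover have "B \<subseteq> top_of_set {0<..} closure_of B"
    using B(2) by (intro closure_of_subset) simp
  ultimately show "((\<lambda>t. prodlaw t B) \<longlongrightarrow> emeasure \<nu> B) at_top"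
    using B(1) f by (intro prodlaw_tendsto[of B w]) auto
qed

end

section \<open>Specialisation to reciprocals of nonpositive variables\<close>

theorem theorem5p6:
  fixes M :: "'a measure" and X Y :: "'a \<Rightarrow> real" and \<rho> \<gamma> :: real
    and \<alpha> a :: "real \<Rightarrow> real" and \<mu> :: "(ereal \<times> ereal) measure"
  assumes "prob_space M"
    and "X \<in> borel_measurable M" and "Y \<in> borel_measurable M"
    and "\<rho> < 0" and "\<gamma> < 0"
    and "\<forall>\<omega>\<in>space M. X \<omega> \<le> 0" and "\<forall>\<omega>\<in>space M. Y \<omega> \<le> 0"
    and "\<forall>\<epsilon>>0. measure M {\<omega>\<in>space M. X \<omega> > - \<epsilon>} > 0"
    and "\<forall>\<epsilon>>0. measure M {\<omega>\<in>space M. Y \<omega> > - \<epsilon>} > 0"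
    and "RV (- \<rho>) \<alpha>" and "RV (- \<gamma>) a"
    and "radon_on ({0..} \<times> {0<..}) \<mu>"
    and "emeasure \<mu> ({0..} \<times> {0<..}) \<noteq> 0"
    and "vague_conv ({0..} \<times> {0<..})
           (\<lambda>t B. ennreal t * emeasure M {\<omega>\<in>space M.
              (neg_recip (X \<omega>) / ereal (\<alpha> t), neg_recip (Y \<omega>) / ereal (a t)) \<in> B}) \<mu>"
    and "\<forall>y>0. nondeg_df (\<lambda>x. emeasure \<mu> ({0..ereal x} \<times> {ereal y<..}))"
    and "\<forall>z>0. ((\<lambda>\<epsilon>. Limsup at_top (\<lambda>t. ennreal t * emeasure M {\<omega>\<in>space M.
              neg_recip (X \<omega>) / ereal (\<alpha> t) > ereal (z / \<epsilon>)})) \<longlongrightarrow> 0) (at_right 0)"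
  shows "RV (- 1 / (\<bar>\<gamma>\<bar> + \<bar>\<rho>\<bar>))
           (\<lambda>x. measure M {\<omega>\<in>space M. recip_e (X \<omega> * Y \<omega>) > ereal x})
       \<and> (\<exists>\<nu> :: ereal measure. radon_on {0<..} \<nu> \<and> nondegenerate_measure {0<..} \<nu> \<and>
            vague_conv {0<..}
              (\<lambda>t B. ennreal t * emeasure M {\<omega>\<in>space M.
                 recip_e (X \<omega> * Y \<omega>) / ereal (\<alpha> t * a t) \<in> B}) \<nu>)"
proof -
  have neg_recip_measurable: "(\<lambda>\<omega>. neg_recip (Z \<omega>)) \<in> borel_measurable M"
    if [measurable]: "Z \<in> borel_measurable M" for Z
    unfolding neg_recip_def by measurable
  have neg_recip_pos: "0 < neg_recip x" if "x \<le> 0" for x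
    using that by (simp add: neg_recip_def)
  interpret J: joint_tail_limit M "\<lambda>\<omega>. neg_recip (X \<omega>)" "\<lambda>\<omega>. neg_recip (Y \<omega>)" \<alpha> a "- \<rho>" "- \<gamma>" \<mu>
    using assms by (auto intro!: joint_tail_limit.intro joint_tail_limit_axioms.intro
        neg_recip_measurable neg_recip_pos)
  \<comment> \<open>The two signs cancel. If a factor is 0, both sides are \<infinity>, because the
    other reciprocal is positive.\<close>
  have "recip_e (x * y) = neg_recip x * neg_recip y" if "x \<le> 0" "y \<le> 0" for x y
    using that neg_recip_pos[of x] neg_recip_pos[of y] by (auto simp: recip_e_def neg_recip_def)
  then have eq: "recip_e (X \<omega> * Y \<omega>) = neg_recip (X \<omega>) * neg_recip (Y \<omega>)" if "\<omega> \<in> space M" for \<omega>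
    using assms(6,7) that by blast
  have "\<bar>\<gamma>\<bar> + \<bar>\<rho>\<bar> = - \<rho> + - \<gamma>" using assms(4,5) by simp
  then have "RV (- 1 / (\<bar>\<gamma>\<bar> + \<bar>\<rho>\<bar>)) J.tail" using J.RV_product_tail by (simp only:)
  moreover have "J.tail = (\<lambda>x. measure M {\<omega>\<in>space M. recip_e (X \<omega> * Y \<omega>) > ereal x})"
    using eq by (auto simp: J.tail_def fun_eq_iff intro!: arg_cong[where f="measure M"])
  moreover have "{\<omega>\<in>space M. recip_e (X \<omega> * Y \<omega>) / ereal c \<in> B} =
      {\<omega>\<in>space M. neg_recip (X \<omega>) * neg_recip (Y \<omega>) / ereal c \<in> B}" for c B
    using eq by auto
  ultimately show ?thesis
    using J.radon_\<nu> J.nondegenerate_\<nu> J.product_vague_conv by auto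
qed

end
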